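(* Let $\mathcal X,\mathcal Y$ be countable sets, $\lambda>0$, and let $c\colon\mathcal X\times\mathcal Y\to\mathbb R$ admit dominating functions $c_{\mathcal X}^-,c_{\mathcal X}^+,c_{\mathcal Y}^-,c_{\mathcal Y}^+$ with weights $\mathcal C_{\mathcal X},\mathcal C_{\mathcal Y},\phi_{\mathcal X},\phi_{\mathcal Y}$. Let $r\in\mathcal P(\mathcal X)$, $s\in\mathcal P(\mathcal Y)$ with $\mathcal C_{\mathcal X},\phi_{\mathcal X}\in\ell^1_r(\mathcal X)$ and $\mathcal C_{\mathcal Y},\phi_{\mathcal Y}\in\ell^1_s(\mathcal Y)$. Put $m=\big(\langle c_{\mathcal X}^-,r\rangle+\langle c_{\mathcal Y}^-,s\rangle\big)/2$. Then there is a unique pair of EROT potentials $(\alpha^\lambda,\beta^\lambda)\in\ell^1_r(\mathcal X)\times\ell^1_s(\mathcal Y)$ (extended to $\mathcal X$ and $\mathcal Y$ by the convention in the context) such that $$\langle\alpha^\lambda,r\rangle=\langle\beta^\lambda,s\rangle=EROT^\lambda(r,s)/2\ \ge\ m,$$ and it satisfies for all $x\in\mathcal X$, $y\in\mathcal Y$ $$c_{\mathcal X}^-(x)-\langle c_{\mathcal X}^+,r\rangle+m-\lambda\log\langle\phi_{\mathcal Y},s\rangle\ \le\ \alpha^\lambda_x\ \le\ c_{\mathcal X}^+(x)+\langle c_{\mathcal Y}^+,s\rangle-m,$$ $$c_{\mathcal Y}^-(y)-\langle c_{\mathcal Y}^+,s\rangle+m-\lambda\log\langle\phi_{\mathcal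 X},r\rangle\ \le\ \beta^\lambda_y\ \le\ c_{\mathcal Y}^+(y)+\langle c_{\mathcal X}^+,r\rangle-m.$$ The EROT plan $\pi^\lambda$ for $(r,s)$ satisfies for all $(x,y)\in\mathcal X\times\mathcal Y$ $$r_xs_y\Big(\phi_{\mathcal X}(x)\phi_{\mathcal Y}(y)\langle\phi_{\mathcal X},r\rangle^2\langle\phi_{\mathcal Y},s\rangle^2\Big)^{-1}\le\pi^\lambda_{xy}\le r_xs_y\Big(\phi_{\mathcal X}(x)\phi_{\mathcal Y}(y)\langle\phi_{\mathcal X},r\rangle\langle\phi_{\mathcal Y},s\rangle\Big).$$ In particular, if $\mathcal C_{\mathcal X}\phi_{\mathcal X}\in\ell^1_r(\mathcal X)$ and $\mathcal C_{\mathcal Y}\phi_{\mathcal Y}\in\ell^1_s(\mathcal Y)$, then $\pi^\lambda\in\ell^1_{\mathcal C_{\mathcal X}\oplus\mathcal C_{\mathcal Y}}(\mathcal X\times\mathcal Y)$, i.e. $\sum_{x,y}(\mathcal C_{\mathcal X}(x)+\mathcal C_{\mathcal Y}(y))\pi^\lambda_{xy}<\infty$.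
   Context: $\mathcal P(\mathcal X)$: probability measures $r=(r_x)$ on the countable set $\mathcal X$; $\ell^1_r(\mathcal X)$: functions with finite expectation under $r$; $\langle f,r\rangle=\sum_xf(x)r_x$. EROT: $\Pi(r,s)$ is the set of couplings of $r,s$; $M(\pi)=\sum_{x,y}\pi_{xy}\log(\pi_{xy}/(r_xs_y))$ (with $0\log0=0$); $EROT^\lambda(r,s)=\inf_{\pi\in\Pi(r,s)}\langle c,\pi\rangle+\lambda M(\pi)$, whose unique minimizer (for $r\otimes s$-integrable $c$) is the EROT plan $\pi^\lambda$. EROT potentials are maximizers $(\alpha,\beta)\in\ell^1_r(\mathcal X)\times\ell^1_s(\mathcal Y)$ of $$\langle\alpha,r\rangle+\langle\beta,s\rangle-\lambda\sum_{x,y}\Big[\exp\Big(\tfrac{\alpha_x+\beta_y-c(x,y)}\lambda\Big)r_xs_y-r_xs_y\Big].$$ On $\mathrm{supp}(r)$, $\mathrm{supp}(s)$ they satisfy $$\alpha_x=-\lambda\log\sum_{y\in\mathcal Y}\exp\Big(\tfrac{\beta_y-c(x,y)}\lambda\Big)s_y,\qquad\beta_y=-\lambda\log\sum_{x\in\mathcal X}\exp\Big(\tfrac{\alpha_x-c(x,y)}\lambda\Big)r_x.$$ Convention: outside the supports (where values are otherwise arbitrary) EROT potentials are defined by the right-hand sides of these formulas. Dominating functions for $c$: real functions $c_{\mathcal X}^-\le c_{\mathcal X}^+$ on $\mathcal X$, $c_{\mathcal Y}^-\le c_{\mathcal Y}^+$ on $\mathcal Y$ with $c_{\mathcal X}^-(x)+c_{\mathcal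 Y}^-(y)\le c(x,y)\le c_{\mathcal X}^+(x)+c_{\mathcal Y}^+(y)$ for all $(x,y)$. Weights: $\mathcal C_{\mathcal X}=1+|c_{\mathcal X}^+|+|c_{\mathcal X}^-|$, $\mathcal C_{\mathcal Y}=1+|c_{\mathcal Y}^+|+|c_{\mathcal Y}^-|$, $\phi_{\mathcal X}=\exp((c_{\mathcal X}^+-c_{\mathcal X}^-)/\lambda)$, $\phi_{\mathcal Y}=\exp((c_{\mathcal Y}^+-c_{\mathcal Y}^-)/\lambda)$. *)

theory Defs
  imports "HOL-Probability.Probability"
begin

text \<open>
  Countable sets are types of class \<open>countable\<close>, probability measures on them are values of type
  \<open>pmf\<close>, \<open>f \<in> \<ell>\<^sup>1\<^sub>r\<close> is \<open>integrable (measure_pmf r) f\<close>, and the pairing of \<open>f\<close> with \<open>r\<close> is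
  \<open>measure_pmf.expectation r f\<close>.
\<close>

text \<open>
  Sum of the positive parts minus sum of the negative parts, so that divergent sums keep their
  infinite value (\<open>infsum\<close> and the Bochner integral would return 0).  The indeterminate case
  is \<open>\<infinity>\<close>; it does not occur for the entropy and the dual penalty below, whose
  negative parts always have a finite sum.
\<close>
definition ext_sum :: "('i \<Rightarrow> real) \<Rightarrow> ereal" where
  "ext_sum f =
     enn2ereal (\<integral>\<^sup>+ i. ennreal (f i) \<partial>count_space UNIV)
     - enn2ereal (\<integral>\<^sup>+ i. ennreal (- f i) \<partial>count_space UNIV)"

definition couplings :: "'a pmf \<Rightarrow> 'b pmf \<Rightarrow> ('a \<times> 'b) pmf set" where
  "couplings r s = {\<pi>. map_pmf fst \<pi> = r \<and> map_pmf snd \<pi> = s}"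

text \<open>
  Used only for couplings of \<open>r\<close> and \<open>s\<close>, which vanish wherever \<open>r \<otimes> s\<close> does; so a division
  by 0 occurs only in terms with factor 0, in agreement with the convention 0 log 0 = 0.
\<close>
definition rel_entropy :: "'a pmf \<Rightarrow> 'b pmf \<Rightarrow> ('a \<times> 'b) pmf \<Rightarrow> ereal" where
  "rel_entropy r s \<pi> =
     ext_sum (\<lambda>(x, y). pmf \<pi> (x, y) * ln (pmf \<pi> (x, y) / (pmf r x * pmf s y)))"

definition EROT_objective ::
  "('a \<Rightarrow> 'b \<Rightarrow> real) \<Rightarrow> real \<Rightarrow> 'a pmf \<Rightarrow> 'b pmf \<Rightarrow> ('a \<times> 'b) pmf \<Rightarrow> ereal" where
  "EROT_objective c lam r s \<pi> =
     ext_sum (\<lambda>(x, y). c x y * pmf \<pi> (x, y)) + ereal lam * rel_entropy r s \<pi>"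

definition EROT ::
  "('a \<Rightarrow> 'b \<Rightarrow> real) \<Rightarrow> real \<Rightarrow> 'a pmf \<Rightarrow> 'b pmf \<Rightarrow> ereal" where
  "EROT c lam r s = (INF \<pi>\<in>couplings r s. EROT_objective c lam r s \<pi>)"

definition is_EROT_plan ::
  "('a \<Rightarrow> 'b \<Rightarrow> real) \<Rightarrow> real \<Rightarrow> 'a pmf \<Rightarrow> 'b pmf \<Rightarrow> ('a \<times> 'b) pmf \<Rightarrow> bool" where
  "is_EROT_plan c lam r s \<pi> \<longleftrightarrow>
     is_arg_min (EROT_objective c lam r s) (\<lambda>\<pi>. \<pi> \<in> couplings r s) \<pi>"

definition EROT_dual ::
  "('a \<Rightarrow> 'b \<Rightarrow> real) \<Rightarrow> real \<Rightarrow> 'a pmf \<Rightarrow> 'b pmf \<Rightarrow> ('a \<Rightarrow> real) \<Rightarrow> ('b \<Rightarrow> real) \<Rightarrow> ereal" where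
  "EROT_dual c lam r s \<alpha> \<beta> =
     ereal (measure_pmf.expectation r \<alpha> + measure_pmf.expectation s \<beta>)
     - ereal lam * ext_sum (\<lambda>(x, y).
         exp ((\<alpha> x + \<beta> y - c x y) / lam) * (pmf r x * pmf s y) - pmf r x * pmf s y)"

text \<open>
  Maximality determines the potentials only on the supports.  The last two conditions fix their
  values off the supports; the integrability demanded there makes the logarithm that of a
  convergent sum.
\<close>
definition EROT_potentials ::
  "('a \<Rightarrow> 'b \<Rightarrow> real) \<Rightarrow> real \<Rightarrow> 'a pmf \<Rightarrow> 'b pmf \<Rightarrow> ('a \<Rightarrow> real) \<Rightarrow> ('b \<Rightarrow> real) \<Rightarrow> bool" where
  "EROT_potentials c lam r s \<alpha> \<beta> \<longleftrightarrow>
     is_arg_max (\<lambda>(\<alpha>, \<beta>). EROT_dual c lam r s \<alpha> \<beta>)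
       (\<lambda>(\<alpha>, \<beta>). integrable (measure_pmf r) \<alpha> \<and> integrable (measure_pmf s) \<beta>) (\<alpha>, \<beta>) \<and>
     (\<forall>x. x \<notin> set_pmf r \<longrightarrow>
        integrable (measure_pmf s) (\<lambda>y. exp ((\<beta> y - c x y) / lam)) \<and>
        \<alpha> x = - lam * ln (measure_pmf.expectation s (\<lambda>y. exp ((\<beta> y - c x y) / lam)))) \<and>
     (\<forall>y. y \<notin> set_pmf s \<longrightarrow>
        integrable (measure_pmf r) (\<lambda>x. exp ((\<alpha> x - c x y) / lam)) \<and>
        \<beta> y = - lam * ln (measure_pmf.expectation r (\<lambda>x. exp ((\<alpha> x - c x y) / lam))))"

definition dominating ::
  "('a \<Rightarrow> 'b \<Rightarrow> real) \<Rightarrow> ('a \<Rightarrow> real) \<Rightarrow> ('a \<Rightarrow> real) \<Rightarrow> ('b \<Rightarrow> real) \<Rightarrow> ('b \<Rightarrow> real) \<Rightarrow> bool" where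
  "dominating c cXm cXp cYm cYp \<longleftrightarrow>
     (\<forall>x. cXm x \<le> cXp x) \<and> (\<forall>y. cYm y \<le> cYp y) \<and>
     (\<forall>x y. cXm x + cYm y \<le> c x y \<and> c x y \<le> cXp x + cYp y)"

definition weight :: "('i \<Rightarrow> real) \<Rightarrow> ('i \<Rightarrow> real) \<Rightarrow> 'i \<Rightarrow> real" where
  "weight cm cp i = 1 + \<bar>cp i\<bar> + \<bar>cm i\<bar>"

definition exp_weight :: "real \<Rightarrow> ('i \<Rightarrow> real) \<Rightarrow> ('i \<Rightarrow> real) \<Rightarrow> 'i \<Rightarrow> real" where
  "exp_weight lam cm cp i = exp ((cp i - cm i) / lam)"

end

theory Submission
  imports Defs
begin

text \<open>
  Substituting the optimal \<open>\<beta> = T \<alpha>\<close> (the soft c-transform) turns the dual into the semidual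
  \<open>G \<alpha> = \<langle>\<alpha>, r\<rangle> + \<langle>T \<alpha>, s\<rangle>\<close>.  By dominated convergence \<open>G\<close> is continuous for pointwise
  convergence on the set of \<open>\<alpha>\<close> with \<open>c\<^sub>X\<^sup>- - K \<le> \<alpha> \<le> c\<^sub>X\<^sup>+ + K\<close>, which is compact by
  Tychonoff's theorem, so \<open>G\<close> attains its maximum there.  After shifting the maximizer to mean
  \<open>m\<close>, a double transform leads back into this set and increases \<open>G\<close> strictly unless it leaves the
  function unchanged on the support of \<open>r\<close>; so the maximizer solves the Schroedinger system.

  A solution \<open>(\<alpha>, \<beta>)\<close> of that system defines the coupling with density
  \<open>exp ((\<alpha> + \<beta> - c) / \<lambda>)\<close>.  The primal objective exceeds \<open>\<langle>\<alpha>, r\<rangle> + \<langle>\<beta>, s\<rangle>\<close> by \<open>\<lambda>\<close> times the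
  relative entropy with respect to this coupling, and the dual objective falls short of it by a
  sum of terms \<open>exp t - 1 - t\<close>.  This gives both optimality and uniqueness.  The pointwise
  bounds follow from the Schroedinger system by Jensen's inequality and monotonicity.
\<close>

subsection \<open>Expectations with respect to probability mass functions\<close>

lemma expectation_pos:
  fixes f :: "'i \<Rightarrow> real"
  assumes "integrable (measure_pmf p) f" and "\<And>i. f i > 0"
  shows "measure_pmf.expectation p f > 0"
  using measure_pmf.expectation_less[of p "\<lambda>i. - f i" 0] assms by simp

text \<open>Jensen's inequality for \<open>exp\<close>: the tangent at the mean \<open>a\<close>
  lies below the graph, and the expectation of this tangent is \<open>exp a\<close>.\<close>

lemma exp_expectation_le:
  fixes f :: "'i \<Rightarrow> real"
  assumes f: "integrable (measure_pmf p) f" and e: "integrable (measure_pmf p) (\<lambda>i. exp (f i))"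
  shows "exp (measure_pmf.expectation p f) \<le> measure_pmf.expectation p (\<lambda>i. exp (f i))"
proof -
  define a where "a = measure_pmf.expectation p f"
  have "exp a * (1 + f i - a) \<le> exp (f i)" for i
  proof -
    have "exp a * (1 + (f i - a)) \<le> exp a * exp (f i - a)"
      by (intro mult_left_mono exp_ge_add_one_self) simp
    then show ?thesis by (simp add: add_diff_eq flip: exp_add)
  qed
  then have "measure_pmf.expectation p (\<lambda>i. exp a * (1 + f i - a)) \<le> measure_pmf.expectation p (\<lambda>i. exp (f i))"
    by (intro integral_mono e) (use f in auto)
  moreover have "measure_pmf.expectation p (\<lambda>i. exp a * (1 + f i - a)) = exp a"
    using f by (simp add: a_def)
  ultimately show ?thesis by (simp add: a_def)
qed

lemma integrable_between:
  fixes f l u :: "'i \<Rightarrow> real"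
  assumes "integrable (measure_pmf p) l" "integrable (measure_pmf p) u"
    and "\<And>i. l i \<le> f i" "\<And>i. f i \<le> u i"
  shows "integrable (measure_pmf p) f"
proof (rule Bochner_Integration.integrable_bound[of _ "\<lambda>i. \<bar>l i\<bar> + \<bar>u i\<bar>"])
  have "\<bar>f i\<bar> \<le> \<bar>l i\<bar> + \<bar>u i\<bar>" for i
    using assms(3,4)[of i] by linarith
  then show "AE i in measure_pmf p. norm (f i) \<le> norm (\<bar>l i\<bar> + \<bar>u i\<bar>)"
    by simp
qed (use assms(1,2) in auto)

text \<open>Tonelli's theorem, obtained from the commutativity of \<open>pair_pmf\<close>.\<close>

lemma nn_integral_pmf_swap:
  "(\<integral>\<^sup>+x. \<integral>\<^sup>+y. f x y \<partial>measure_pmf q \<partial>measure_pmf p) = (\<integral>\<^sup>+y. \<integral>\<^sup>+x. f x y \<partial>measure_pmf p \<partial>measure_pmf q)"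
proof -
  have "(\<integral>\<^sup>+x. \<integral>\<^sup>+y. f x y \<partial>measure_pmf q \<partial>measure_pmf p) = (\<integral>\<^sup>+z. f (fst z) (snd z) \<partial>pair_pmf p q)"
    by (simp add: nn_integral_pair_pmf')
  also have "\<dots> = (\<integral>\<^sup>+z. f (snd z) (fst z) \<partial>pair_pmf q p)"
    by (subst pair_commute_pmf) (simp add: case_prod_unfold)
  also have "\<dots> = (\<integral>\<^sup>+y. \<integral>\<^sup>+x. f x y \<partial>measure_pmf p \<partial>measure_pmf q)"
    by (simp add: nn_integral_pair_pmf')
  finally show ?thesis .
qed

text \<open>Both iterated integrals are compared as nonnegative integrals, so finiteness of the one
  yields integrability for the other.\<close>

lemma expectation_swap_nonneg:
  fixes e :: "'i \<Rightarrow> 'j \<Rightarrow> real"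
  assumes e: "\<And>x y. e x y \<ge> 0"
    and q: "\<And>x. integrable (measure_pmf q) (e x)" and p: "\<And>y. integrable (measure_pmf p) (\<lambda>x. e x y)"
    and pq: "integrable (measure_pmf q) (\<lambda>y. measure_pmf.expectation p (\<lambda>x. e x y))"
  shows "integrable (measure_pmf p) (\<lambda>x. measure_pmf.expectation q (e x))"
    and "measure_pmf.expectation p (\<lambda>x. measure_pmf.expectation q (e x)) =
      measure_pmf.expectation q (\<lambda>y. measure_pmf.expectation p (\<lambda>x. e x y))"
proof -
  have "(\<integral>\<^sup>+x. ennreal (measure_pmf.expectation q (e x)) \<partial>measure_pmf p) =
    (\<integral>\<^sup>+x. \<integral>\<^sup>+y. ennreal (e x y) \<partial>measure_pmf q \<partial>measure_pmf p)"
    by (simp add: nn_integral_eq_integral q e)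
  also have "\<dots> = (\<integral>\<^sup>+y. \<integral>\<^sup>+x. ennreal (e x y) \<partial>measure_pmf p \<partial>measure_pmf q)"
    by (rule nn_integral_pmf_swap)
  also have "\<dots> = ennreal (measure_pmf.expectation q (\<lambda>y. measure_pmf.expectation p (\<lambda>x. e x y)))"
    by (simp add: nn_integral_eq_integral p e pq)
  finally have *: "(\<integral>\<^sup>+x. ennreal (measure_pmf.expectation q (e x)) \<partial>measure_pmf p) =
    ennreal (measure_pmf.expectation q (\<lambda>y. measure_pmf.expectation p (\<lambda>x. e x y)))" .
  show int: "integrable (measure_pmf p) (\<lambda>x. measure_pmf.expectation q (e x))"
    by (rule integrableI_nonneg) (simp_all add: * e)
  show "measure_pmf.expectation p (\<lambda>x. measure_pmf.expectation q (e x)) =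
      measure_pmf.expectation q (\<lambda>y. measure_pmf.expectation p (\<lambda>x. e x y))"
    using * by (subst (asm) nn_integral_eq_integral[OF int]) (simp_all add: e)
qed

subsection \<open>The soft c-transform\<close>

text \<open>
  Where the exponential is not integrable, the expectation is 0 and the value is 0, by \<open>ln 0 = 0\<close>.
\<close>
definition ctransform ::
  "real \<Rightarrow> 'b pmf \<Rightarrow> ('a \<Rightarrow> 'b \<Rightarrow> real) \<Rightarrow> ('b \<Rightarrow> real) \<Rightarrow> 'a \<Rightarrow> real" where
  "ctransform lam s c g x =
     - lam * ln (measure_pmf.expectation s (\<lambda>y. exp ((g y - c x y) / lam)))"

text \<open>Maximality determines functions only on supports. As the transform averages over
  \<open>s\<close>, agreement there already gives equal transforms at every point of the other
  space.\<close>

lemma ctransform_cong: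
  assumes "\<And>y. y \<in> set_pmf s \<Longrightarrow> g y = g' y"
  shows "ctransform lam s c g = ctransform lam s c g'"
proof
  fix x
  have "measure_pmf.expectation s (\<lambda>y. exp ((g y - c x y) / lam)) =
        measure_pmf.expectation s (\<lambda>y. exp ((g' y - c x y) / lam))"
    by (rule integral_cong_AE) (auto simp: AE_measure_pmf_iff assms)
  then show "ctransform lam s c g x = ctransform lam s c g' x" by (simp add: ctransform_def)
qed

text \<open>The mean of the kernel is positive, hence equal to
  \<open>exp (- ctransform lam s c g x / lam)\<close>, and \<open>exp (a / lam)\<close> factors out.
  For \<open>a = ctransform lam s c g x\<close> the value is 1, which is the marginal condition for
  the plan.\<close>

lemma expectation_exp_diff_ctransform:
  assumes "lam > 0" and "integrable (measure_pmf s) (\<lambda>y. exp ((g y - c x y) / lam))"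
  shows "measure_pmf.expectation s (\<lambda>y. exp ((a + g y - c x y) / lam)) =
    exp ((a - ctransform lam s c g x) / lam)"
proof -
  have "measure_pmf.expectation s (\<lambda>y. exp ((a + g y - c x y) / lam)) =
     measure_pmf.expectation s (\<lambda>y. exp (a / lam) * exp ((g y - c x y) / lam))"
    by (rule Bochner_Integration.integral_cong) (simp_all flip: exp_add add: diff_divide_distrib add_divide_distrib)
  also have "\<dots> = exp (a / lam) * measure_pmf.expectation s (\<lambda>y. exp ((g y - c x y) / lam))"
    by (rule integral_mult_right_zero)
  also have "measure_pmf.expectation s (\<lambda>y. exp ((g y - c x y) / lam)) = exp (- ctransform lam s c g x / lam)"
    unfolding ctransform_def using expectation_pos[OF assms(2)] assms(1) by simp
  also have "exp (a / lam) * exp (- ctransform lam s c g x / lam) = exp ((a - ctransform lam s c g x) / lam)"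
    by (simp add: diff_divide_distrib flip: exp_add)
  finally show ?thesis .
qed

lemma ctransform_shift:
  assumes "lam > 0" and "integrable (measure_pmf s) (\<lambda>y. exp ((g y - c x y) / lam))"
  shows "ctransform lam s c (\<lambda>y. g y + t) x = ctransform lam s c g x - t"
proof -
  have "measure_pmf.expectation s (\<lambda>y. exp ((g y + t - c x y) / lam)) =
     exp ((t - ctransform lam s c g x) / lam)"
    using expectation_exp_diff_ctransform[of lam s g c x t, OF assms] by (simp add: add.commute)
  then show ?thesis using assms(1) by (simp add: ctransform_def[of _ _ _ "\<lambda>y. g y + t"])
qed

lemma exp_weight_pos [simp]: "exp_weight lam cm cp i > 0"
  by (simp add: exp_weight_def)

lemma abs_exp_weight [simp]: "\<bar>exp_weight lam cm cp i\<bar> = exp_weight lam cm cp i"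
  by (simp add: exp_weight_def)

text \<open>
  Only integrability over the second space is assumed; swapping the arguments of the cost yields
  the statements for the other transform.
\<close>
locale half_dominated =
  fixes lam :: real and s :: "'b pmf" and c :: "'a \<Rightarrow> 'b \<Rightarrow> real"
    and cXm cXp :: "'a \<Rightarrow> real" and cYm cYp :: "'b \<Rightarrow> real"
  assumes lam: "lam > 0"
    and lower: "\<And>x y. cXm x + cYm y \<le> c x y" and upper: "\<And>x y. c x y \<le> cXp x + cYp y"
    and int_cYm: "integrable (measure_pmf s) cYm" and int_cYp: "integrable (measure_pmf s) cYp"
    and int_phi: "integrable (measure_pmf s) (exp_weight lam cYm cYp)"
begin

abbreviation T :: "('b \<Rightarrow> real) \<Rightarrow> 'a \<Rightarrow> real" where
  "T \<equiv> ctransform lam s c"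

text \<open>This follows from \<open>g y - c x y \<le> cYp y + K - cXm x - cYm y\<close>. The
  right-hand side serves as majorant for integrability, for the lower bound on the transform and for
  dominated convergence.\<close>

lemma kernel_le:
  assumes "g y \<le> cYp y + K"
  shows "exp ((g y - c x y) / lam) \<le> exp ((K - cXm x) / lam) * exp_weight lam cYm cYp y"
  using assms lower[of x y] lam
  by (auto simp: exp_weight_def simp flip: exp_add add_divide_distrib intro!: divide_right_mono)

lemma integrable_kernel:
  assumes "\<And>y. g y \<le> cYp y + K"
  shows "integrable (measure_pmf s) (\<lambda>y. exp ((g y - c x y) / lam))"
  by (rule Bochner_Integration.integrable_bound[of _ "\<lambda>y. exp ((K - cXm x) / lam) * exp_weight lam cYm cYp y"])
    (use int_phi kernel_le[of g _ K x, OF assms] in \<open>auto simp: abs_mult\<close>)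

lemma ctransform_ge:
  assumes g: "\<And>y. g y \<le> cYp y + K"
  shows "T g x \<ge> cXm x - K - lam * ln (measure_pmf.expectation s (exp_weight lam cYm cYp))"
proof -
  let ?E = "measure_pmf.expectation s (\<lambda>y. exp ((g y - c x y) / lam))"
  let ?F = "measure_pmf.expectation s (exp_weight lam cYm cYp)"
  have "?E \<le> measure_pmf.expectation s (\<lambda>y. exp ((K - cXm x) / lam) * exp_weight lam cYm cYp y)"
    by (intro integral_mono integrable_kernel[OF g] kernel_le[OF g] integrable_mult_right int_phi)
  also have "\<dots> = exp ((K - cXm x) / lam) * ?F"
    by simp
  finally have le: "?E \<le> exp ((K - cXm x) / lam) * ?F" .
  have pos: "?E > 0" "?F > 0"
    by (auto intro!: expectation_pos integrable_kernel[OF g] int_phi)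
  have "ln ?E \<le> ln (exp ((K - cXm x) / lam) * ?F)"
    using le pos by simp
  also have "\<dots> = (K - cXm x) / lam + ln ?F"
    using pos by (simp add: ln_mult)
  finally have "lam * ln ?E \<le> K - cXm x + lam * ln ?F"
    using lam by (simp add: field_simps)
  then show ?thesis by (simp add: ctransform_def)
qed

text \<open>A soft minimum lies below the mean: Jensen's inequality bounds the transform by the mean
  of \<open>c x y - g y\<close>, and the cost is then replaced by its upper dominating
  function.\<close>

lemma ctransform_le:
  assumes k: "integrable (measure_pmf s) (\<lambda>y. exp ((g y - c x y) / lam))"
    and int: "integrable (measure_pmf s) g"
  shows "T g x \<le> cXp x + measure_pmf.expectation s cYp - measure_pmf.expectation s g"
proof -
  have "integrable (measure_pmf s) (c x)"
    by (rule integrable_between[of _ "\<lambda>y. cXm x + cYm y" "\<lambda>y. cXp x + cYp y"])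
      (use lower upper int_cYm int_cYp in auto)
  note int' = int this
  let ?E = "measure_pmf.expectation s (\<lambda>y. exp ((g y - c x y) / lam))"
  have "exp (measure_pmf.expectation s (\<lambda>y. (g y - c x y) / lam)) \<le> ?E"
    by (rule exp_expectation_le) (use int' k in auto)
  then have "measure_pmf.expectation s (\<lambda>y. (g y - c x y) / lam) \<le> ln ?E"
    using expectation_pos[OF k] by (subst ln_ge_iff) auto
  then have "T g x \<le> measure_pmf.expectation s (c x) - measure_pmf.expectation s g"
    using lam int' by (simp add: ctransform_def field_simps)
  also have "measure_pmf.expectation s (c x) \<le> measure_pmf.expectation s (\<lambda>y. cXp x + cYp y)"
    by (rule integral_mono) (use int' int_cYp upper in auto)
  finally show ?thesis using int_cYp by simp
qed

lemma ctransform_tendsto: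
  assumes g: "\<And>n y. g n y \<le> cYp y + K" and lim: "\<And>y. (\<lambda>n. g n y) \<longlonglongrightarrow> h y"
  shows "(\<lambda>n. T (g n) x) \<longlonglongrightarrow> T h x"
proof -
  have h: "h y \<le> cYp y + K" for y
    using LIMSEQ_le_const2[OF lim[of y]] g by blast
  have "(\<lambda>n. measure_pmf.expectation s (\<lambda>y. exp ((g n y - c x y) / lam)))
    \<longlonglongrightarrow> measure_pmf.expectation s (\<lambda>y. exp ((h y - c x y) / lam))"
  proof (rule integral_dominated_convergence[where w = "\<lambda>y. exp ((K - cXm x) / lam) * exp_weight lam cYm cYp y"])
    show "AE y in measure_pmf s. norm (exp ((g n y - c x y) / lam))
       \<le> exp ((K - cXm x) / lam) * exp_weight lam cYm cYp y" for n
      using kernel_le[of "g n", OF g] by simp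
    show "AE y in measure_pmf s. (\<lambda>n. exp ((g n y - c x y) / lam)) \<longlonglongrightarrow> exp ((h y - c x y) / lam)"
      using lam by (intro AE_I2 tendsto_intros lim) auto
  qed (use int_phi in auto)
  \<comment> \<open>The limit is positive, so \<open>ln\<close> is continuous there.\<close>
  moreover have "measure_pmf.expectation s (\<lambda>y. exp ((h y - c x y) / lam)) > 0"
    by (intro expectation_pos integrable_kernel[OF h]) auto
  ultimately show ?thesis
    unfolding ctransform_def by (intro tendsto_intros) auto
qed

end

text \<open>
  With \<open>W = exp ((f - f') / lam)\<close>, exchanging the order of summation shows that \<open>W\<close> has
  mean 1, and \<open>f' - f = - lam * ln W \<ge> lam * (1 - W)\<close>.
\<close>
lemma ctransform_twice_improves:
  fixes f :: "'a \<Rightarrow> real"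
  assumes lam: "lam > 0"
    and g: "g = ctransform lam r (\<lambda>y x. c x y) f" and f': "f' = ctransform lam s c g"
    and int: "integrable (measure_pmf r) f" "integrable (measure_pmf r) f'"
    and kr: "\<And>y. integrable (measure_pmf r) (\<lambda>x. exp ((f x - c x y) / lam))"
    and ks: "\<And>x. integrable (measure_pmf s) (\<lambda>y. exp ((g y - c x y) / lam))"
  shows "measure_pmf.expectation r f \<le> measure_pmf.expectation r f'"
    and "measure_pmf.expectation r f' = measure_pmf.expectation r f \<Longrightarrow> x \<in> set_pmf r \<Longrightarrow> f' x = f x"
proof -
  define e where "e x y = exp ((f x + g y - c x y) / lam)" for x y
  define W where "W x = exp ((f x - f' x) / lam)" for x
  have W: "measure_pmf.expectation s (e x) = W x" for x
    using expectation_exp_diff_ctransform[OF lam ks] by (simp add: e_def[abs_def] W_def f')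
  \<comment> \<open>Because \<open>g\<close> is the transform of \<open>f\<close>, the kernel has
    mean 1 in \<open>x\<close> for each \<open>y\<close>; exchanging the sums turns this into the
    mean of \<open>W\<close>.\<close>
  have Z: "measure_pmf.expectation r (\<lambda>x. e x y) = 1" for y
    using expectation_exp_diff_ctransform[of lam r f "\<lambda>y x. c x y" y "g y", OF lam kr]
    by (simp add: e_def g add.commute)
  have e_eq: "e x y = exp (g y / lam) * exp ((f x - c x y) / lam)" "e x y = exp (f x / lam) * exp ((g y - c x y) / lam)" for x y
    by (simp_all add: e_def diff_divide_distrib add_divide_distrib flip: exp_add)
  have es: "integrable (measure_pmf s) (e x)" for x
    using integrable_mult_right[OF ks, of "exp (f x / lam)" x] unfolding e_eq(2)[abs_def] .
  have er: "integrable (measure_pmf r) (\<lambda>x. e x y)" for y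
    using integrable_mult_right[OF kr, of "exp (g y / lam)" y] unfolding e_eq(1)[abs_def] .
  have *: "integrable (measure_pmf r) W" "measure_pmf.expectation r W = 1"
    using expectation_swap_nonneg[of e s r, OF _ es er] by (simp_all add: W Z) (simp_all add: e_def)
  \<comment> \<open>The term \<open>lam * (1 - W x)\<close> has mean 0, so the mean of the
    nonnegative function \<open>d\<close> is exactly the gain.\<close>
  define d where "d x = f' x - f x - lam * (1 - W x)" for x
  have d: "d x \<ge> 0" for x
    using exp_ge_add_one_self[of "(f x - f' x) / lam"] lam by (simp add: d_def W_def field_simps)
  have d_int: "integrable (measure_pmf r) d"
    using int * by (simp add: d_def[abs_def])
  have d_exp: "measure_pmf.expectation r d = measure_pmf.expectation r f' - measure_pmf.expectation r f"
    using int * by (simp add: d_def[abs_def])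
  show "measure_pmf.expectation r f \<le> measure_pmf.expectation r f'"
    using d_exp Bochner_Integration.integral_nonneg[of "measure_pmf r" d] d by simp
  assume eq: "measure_pmf.expectation r f' = measure_pmf.expectation r f" and x: "x \<in> set_pmf r"
  have "AE x in measure_pmf r. d x = 0"
    using integral_nonneg_eq_0_iff_AE[OF d_int] d d_exp eq by simp
  then have "d x = 0" using x by (simp add: AE_measure_pmf_iff)
  then have "W x = 1 + (f x - f' x) / lam" using lam by (simp add: d_def field_simps)
  \<comment> \<open>Equality in \<open>1 + t \<le> exp t\<close> holds only at
    \<open>t = 0\<close>.\<close>
  then have "(f x - f' x) / lam = 0"
    unfolding W_def by (metis exp_gt_zero ln_exp ln_eq_minus_one add_diff_cancel_left' exp_zero)
  then show "f' x = f x" using lam by simp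
qed

subsection \<open>Existence of a solution of the Schroedinger system\<close>

text \<open>The second instance has the transposed cost, so \<open>flip.T\<close> sends functions of
  \<open>x\<close> to functions of \<open>y\<close>. The assumption \<open>cX_le\<close> places
  \<open>cXm\<close> in a band of any nonnegative width \<open>K\<close>.\<close>

locale dominated_cost = half_dominated lam s c cXm cXp cYm cYp
    + flip: half_dominated lam r "\<lambda>y x. c x y" cYm cYp cXm cXp
  for lam :: real and r :: "'a::countable pmf" and s :: "'b::countable pmf"
    and c :: "'a \<Rightarrow> 'b \<Rightarrow> real" and cXm cXp cYm cYp +
  assumes cX_le: "\<And>x. cXm x \<le> cXp x"
begin

text \<open>Kernel integrability is demanded at all points, so that neither transform takes its
  default value. The two equations also hold off the supports, which builds in the convention for
  extending potentials.\<close>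

definition schroedinger_pair :: "('a \<Rightarrow> real) \<Rightarrow> ('b \<Rightarrow> real) \<Rightarrow> bool" where
  "schroedinger_pair \<alpha> \<beta> \<longleftrightarrow>
     integrable (measure_pmf r) \<alpha> \<and> integrable (measure_pmf s) \<beta> \<and>
     (\<forall>x. integrable (measure_pmf s) (\<lambda>y. exp ((\<beta> y - c x y) / lam))) \<and>
     (\<forall>y. integrable (measure_pmf r) (\<lambda>x. exp ((\<alpha> x - c x y) / lam))) \<and>
     \<alpha> = T \<beta> \<and> \<beta> = flip.T \<alpha>"

lemma schroedinger_pairD:
  assumes "schroedinger_pair \<alpha> \<beta>"
  shows "integrable (measure_pmf r) \<alpha>" "integrable (measure_pmf s) \<beta>"
    and "integrable (measure_pmf s) (\<lambda>y. exp ((\<beta> y - c x y) / lam))"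
    and "integrable (measure_pmf r) (\<lambda>x. exp ((\<alpha> x - c x y) / lam))"
    and "T \<beta> x = \<alpha> x" "flip.T \<alpha> y = \<beta> y"
  using assms unfolding schroedinger_pair_def by (blast, blast, blast, blast, metis, metis)

section \<open>Maximization of the semidual over a compact band\<close>

definition lower_mean :: real where
  "lower_mean = (measure_pmf.expectation r cXm + measure_pmf.expectation s cYm) / 2"

definition semidual :: "('a \<Rightarrow> real) \<Rightarrow> real" where
  "semidual a = measure_pmf.expectation r a + measure_pmf.expectation s (flip.T a)"

definition band :: "real \<Rightarrow> ('a \<Rightarrow> real) set" where
  "band K = {a. \<forall>x. a x \<in> {cXm x - K..cXp x + K}}"

lemma compact_band: "compact (band K)"
proof -
  have "compactin (product_topology (\<lambda>_. euclidean) UNIV) (PiE UNIV (\<lambda>x. {cXm x - K..cXp x + K}))"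
    by (subst compactin_PiE) (auto simp: compactin_euclidean_iff)
  then show ?thesis
    by (simp add: band_def PiE_UNIV_domain Pi_def euclidean_product_topology compactin_euclidean_iff)
qed

text \<open>Both sides of the band are integrable, and its upper side keeps the kernel integrable.
  The upper bound on the transform contains the mean of \<open>a\<close>, which the band bounds from
  below; so the transforms of all members share one integrable majorant.\<close>

lemma
  assumes "a \<in> band K"
  shows integrable_band: "integrable (measure_pmf r) a"
    and ctransform_band_ge: "flip.T a y \<ge> cYm y - K - lam * ln (measure_pmf.expectation r (exp_weight lam cXm cXp))"
    and ctransform_band_le: "flip.T a y \<le> cYp y + measure_pmf.expectation r cXp - measure_pmf.expectation r a"
    and expectation_band_ge: "measure_pmf.expectation r a \<ge> measure_pmf.expectation r cXm - K"
    and integrable_ctransform_band: "integrable (measure_pmf s) (flip.T a)"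
    and integrable_kernel_band: "integrable (measure_pmf r) (\<lambda>x. exp ((a x - c x y) / lam))"
proof -
  have a: "a x \<le> cXp x + K" "cXm x - K \<le> a x" for x using assms by (auto simp: band_def)
  show int: "integrable (measure_pmf r) a"
    by (rule integrable_between[of _ "\<lambda>x. cXm x - K" "\<lambda>x. cXp x + K"])
      (use a flip.int_cYm flip.int_cYp in auto)
  show ge: "flip.T a y \<ge> cYm y - K - lam * ln (measure_pmf.expectation r (exp_weight lam cXm cXp))" for y
    by (rule flip.ctransform_ge[OF a(1)])
  show le: "flip.T a y \<le> cYp y + measure_pmf.expectation r cXp - measure_pmf.expectation r a" for y
    by (rule flip.ctransform_le[OF flip.integrable_kernel[OF a(1)] int])
  have "measure_pmf.expectation r (\<lambda>x. cXm x - K) \<le> measure_pmf.expectation r a"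
    by (rule integral_mono) (use a flip.int_cYm int in auto)
  then show "measure_pmf.expectation r a \<ge> measure_pmf.expectation r cXm - K"
    using flip.int_cYm by simp
  show "integrable (measure_pmf s) (flip.T a)"
    by (rule integrable_between[OF _ _ ge le]) (use int_cYm int_cYp in auto)
  show "integrable (measure_pmf r) (\<lambda>x. exp ((a x - c x y) / lam))"
    by (rule flip.integrable_kernel[OF a(1)])
qed

lemma continuous_on_semidual: "continuous_on (band K) semidual"
  \<comment> \<open>Countability of the index type makes the product topology first countable, so
    sequences decide continuity and dominated convergence applies.\<close>
  unfolding continuous_on_sequentially
proof (intro ballI allI impI)
  fix a u assume a: "a \<in> band K" and "(\<forall>n. u n \<in> band K) \<and> u \<longlonglongrightarrow> a"
  then have u: "u n \<in> band K" and lim: "u \<longlonglongrightarrow> a" for n by auto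
  have lim: "(\<lambda>n. u n x) \<longlonglongrightarrow> a x" for x
    by (rule isCont_tendsto_compose[OF _ lim])
      (rule continuous_on_interior[OF continuous_on_product_coordinates], simp)
  have bd: "cXm x - K \<le> u n x" "u n x \<le> cXp x + K" for n x using u[of n] by (auto simp: band_def)
  let ?w = "\<lambda>x. \<bar>cXm x\<bar> + \<bar>cXp x\<bar> + \<bar>K\<bar>"
  have 1: "(\<lambda>n. measure_pmf.expectation r (u n)) \<longlonglongrightarrow> measure_pmf.expectation r a"
  proof (rule integral_dominated_convergence[where w = ?w])
    have "\<bar>u n x\<bar> \<le> ?w x" for n x using bd[where n=n and x=x] by linarith
    then show "AE x in measure_pmf r. norm (u n x) \<le> ?w x" for n by simp
  qed (use flip.int_cYm flip.int_cYp lim in auto)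
  let ?L = "K + lam * ln (measure_pmf.expectation r (exp_weight lam cXm cXp))"
  \<comment> \<open>The mean of \<open>u n\<close> in \<open>ctransform_band_le\<close> is replaced
    by its lower bound, which removes the dependence on \<open>n\<close>.\<close>
  let ?U = "measure_pmf.expectation r cXp - measure_pmf.expectation r cXm + K"
  have 2: "(\<lambda>n. measure_pmf.expectation s (flip.T (u n))) \<longlonglongrightarrow> measure_pmf.expectation s (flip.T a)"
  proof (rule integral_dominated_convergence[where w = "\<lambda>y. \<bar>cYm y\<bar> + \<bar>cYp y\<bar> + \<bar>?L\<bar> + \<bar>?U\<bar>"])
    have "\<bar>flip.T (u n) y\<bar> \<le> \<bar>cYm y\<bar> + \<bar>cYp y\<bar> + \<bar>?L\<bar> + \<bar>?U\<bar>" for n y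
      using ctransform_band_ge[OF u, of y n] ctransform_band_le[OF u, where y=y and n1=n]
        expectation_band_ge[OF u, of n] by linarith
    then show "AE y in measure_pmf s. norm (flip.T (u n) y) \<le> \<bar>cYm y\<bar> + \<bar>cYp y\<bar> + \<bar>?L\<bar> + \<bar>?U\<bar>" for n
      by simp
    show "AE y in measure_pmf s. (\<lambda>n. flip.T (u n) y) \<longlonglongrightarrow> flip.T a y"
      by (intro AE_I2 flip.ctransform_tendsto[OF bd(2) lim])
  qed (use int_cYm int_cYp in auto)
  show "(semidual \<circ> u) \<longlonglongrightarrow> semidual a"
    unfolding semidual_def comp_def by (intro tendsto_add 1 2)
qed

lemma semidual_maximizer:
  obtains a K where "a \<in> band K" and "semidual a \<ge> 2 * lower_mean"
    and "K \<ge> \<bar>measure_pmf.expectation r cXp - lower_mean\<bar> + \<bar>measure_pmf.expectation s cYp - lower_mean\<bar>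
      + \<bar>lam * ln (measure_pmf.expectation s (exp_weight lam cYm cYp))\<bar>"
    and "\<And>a'. a' \<in> band K \<Longrightarrow> semidual a' \<le> semidual a"
proof -
  \<comment> \<open>\<open>K\<close> absorbs the constants in the lower and upper bounds on the
    double transform of a function with mean \<open>lower_mean\<close>, so that this transform falls
    back into the band.\<close>
  define K where "K = \<bar>measure_pmf.expectation r cXp - lower_mean\<bar> + \<bar>measure_pmf.expectation s cYp - lower_mean\<bar>
      + \<bar>lam * ln (measure_pmf.expectation s (exp_weight lam cYm cYp))\<bar>"
  have K: "K \<ge> 0" by (simp add: K_def)
  have base: "cXm \<in> band K" using K cX_le by (auto simp: band_def intro: add_increasing2)
  obtain a where a: "a \<in> band K" "\<And>a'. a' \<in> band K \<Longrightarrow> semidual a' \<le> semidual a"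
    using continuous_attains_sup[OF compact_band _ continuous_on_semidual, of K] base by auto
  \<comment> \<open>The comparison function is \<open>cXm\<close>: since
    \<open>cXm x - c x y \<le> - cYm y\<close>, its transform lies above \<open>cYm\<close>, and its
    semidual is at least the sum of the two lower means.\<close>
  have "flip.T cXm y \<ge> cYm y" for y
  proof -
    have "(cXm x - c x y) / lam \<le> - cYm y / lam" for x
      by (rule divide_right_mono) (use lam lower[of x y] in auto)
    then have "measure_pmf.expectation r (\<lambda>x. exp ((cXm x - c x y) / lam)) \<le> measure_pmf.expectation r (\<lambda>x. exp (- cYm y / lam))"
      by (intro integral_mono integrable_kernel_band[OF base]) simp_all
    then have "ln (measure_pmf.expectation r (\<lambda>x. exp ((cXm x - c x y) / lam))) \<le> ln (exp (- cYm y / lam))"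
      using expectation_pos[OF integrable_kernel_band[OF base]] by (subst ln_le_cancel_iff) auto
    then show ?thesis using lam by (simp add: ctransform_def field_simps)
  qed
  then have "measure_pmf.expectation s cYm \<le> measure_pmf.expectation s (flip.T cXm)"
    by (intro integral_mono int_cYm integrable_ctransform_band[OF base])
  then have "semidual cXm \<ge> 2 * lower_mean" by (simp add: semidual_def lower_mean_def)
  then have "semidual a \<ge> 2 * lower_mean" using a(2)[OF base] by linarith
  then show ?thesis by (rule that[OF a(1) _ _ a(2)]) (simp_all add: K_def)
qed

lemma schroedinger_pair_exists:
  obtains \<alpha> \<beta> where "schroedinger_pair \<alpha> \<beta>"
    and "measure_pmf.expectation r \<alpha> + measure_pmf.expectation s \<beta> \<ge> 2 * lower_mean"
proof -
  obtain a K where a: "a \<in> band K" and Ga: "semidual a \<ge> 2 * lower_mean"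
    and K: "K \<ge> \<bar>measure_pmf.expectation r cXp - lower_mean\<bar> + \<bar>measure_pmf.expectation s cYp - lower_mean\<bar>
      + \<bar>lam * ln (measure_pmf.expectation s (exp_weight lam cYm cYp))\<bar>"
    and max: "\<And>a'. a' \<in> band K \<Longrightarrow> semidual a' \<le> semidual a"
    by (rule semidual_maximizer) blast
  \<comment> \<open>Shifting \<open>a\<close> by \<open>t\<close> shifts its transform by
    \<open>- t\<close>, so the semidual keeps its value. The mean \<open>lower_mean\<close> is the
    one for which \<open>K\<close> was chosen.\<close>
  define t where "t = lower_mean - measure_pmf.expectation r a"
  define a0 where "a0 = (\<lambda>x. a x + t)"
  define b where "b = flip.T a0"
  define a1 where "a1 = T b"
  \<comment> \<open>The shifted function may leave \<open>band K\<close>; the wider band only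
    supplies integrability.\<close>
  define K' where "K' = K + \<bar>t\<bar>"
  have "cXm x - K' \<le> a0 x \<and> a0 x \<le> cXp x + K'" for x
    using a abs_ge_self[of t] abs_ge_minus_self[of t] by (auto simp: band_def a0_def K'_def dest!: spec[of _ x])
  then have "a0 \<in> band K'"
    by (simp add: band_def)
  note a0 = this integrable_band[OF this] integrable_kernel_band[OF this]
  have b_eq: "b y = flip.T a y - t" for y
    unfolding b_def a0_def by (rule ctransform_shift[OF lam integrable_kernel_band[OF a]])
  have int_b: "integrable (measure_pmf s) b"
    unfolding b_def by (rule integrable_ctransform_band[OF a0(1)])
  have mean_a0: "measure_pmf.expectation r a0 = lower_mean"
    using integrable_band[OF a] by (simp add: a0_def t_def)
  have sum: "measure_pmf.expectation r a0 + measure_pmf.expectation s b = semidual a"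
    using integrable_band[OF a] integrable_ctransform_band[OF a]
    by (simp add: semidual_def a0_def b_eq[abs_def])
  have mean_b: "measure_pmf.expectation s b \<ge> lower_mean"
    using sum mean_a0 Ga by linarith
  have b_le: "b y \<le> cYp y + (measure_pmf.expectation r cXp - lower_mean)" for y
    using ctransform_band_le[OF a0(1), of y] mean_a0 by (simp add: b_def)
  have kb: "integrable (measure_pmf s) (\<lambda>y. exp ((b y - c x y) / lam))" for x
    by (rule integrable_kernel[OF b_le])
  have "a1 x \<ge> cXm x - K" "a1 x \<le> cXp x + K" for x
    using ctransform_ge[of b, OF b_le, of x] ctransform_le[OF kb int_b, of x] K mean_b
    unfolding a1_def by linarith+
  then have a1: "a1 \<in> band K" by (simp add: band_def)
  note int_a1 = integrable_band[OF a1]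
  note int_b1 = integrable_ctransform_band[OF a1]
  \<comment> \<open>The step from \<open>a0\<close> to \<open>a1\<close> and the step from
    \<open>b\<close> to \<open>flip.T a1\<close> do not lower the means. Since
    \<open>semidual a1 \<le> semidual a\<close>, the first step gains nothing, and its equality case
    gives \<open>a1 = a0\<close> on the support of \<open>r\<close>.\<close>
  have 1: "measure_pmf.expectation r a0 \<le> measure_pmf.expectation r a1"
    by (rule ctransform_twice_improves(1)[OF lam b_def a1_def a0(2) int_a1 a0(3) kb])
  have 2: "measure_pmf.expectation s b \<le> measure_pmf.expectation s (flip.T a1)"
    by (rule ctransform_twice_improves(1)[of lam a1 s "\<lambda>y x. c x y" b _ r,
          OF lam a1_def refl int_b int_b1 kb integrable_kernel_band[OF a1]])
  have "measure_pmf.expectation r a1 = measure_pmf.expectation r a0"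
    using 1 2 sum max[OF a1] unfolding semidual_def by linarith
  then have "a1 x = a0 x" if "x \<in> set_pmf r" for x
    using ctransform_twice_improves(2)[OF lam b_def a1_def a0(2) int_a1 a0(3) kb] that by blast
  \<comment> \<open>The pair uses \<open>a1\<close> rather than \<open>a0\<close>: it equals
    \<open>T b\<close> everywhere, and agreement with \<open>a0\<close> on the support suffices for
    the other equation.\<close>
  then have "flip.T a1 = b"
    unfolding b_def by (intro ctransform_cong)
  then have "schroedinger_pair a1 b"
    unfolding schroedinger_pair_def
    using int_a1 int_b kb integrable_kernel_band[OF a1] a1_def by metis
  moreover have "measure_pmf.expectation r a1 + measure_pmf.expectation s b \<ge> 2 * lower_mean"
    using 1 sum Ga by linarith
  ultimately show ?thesis by (rule that)
qed

section \<open>Normalization to equal means\<close>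

lemma schroedinger_pair_shift:
  assumes "schroedinger_pair \<alpha> \<beta>"
  shows "schroedinger_pair (\<lambda>x. \<alpha> x + t) (\<lambda>y. \<beta> y - t)"
proof -
  note D = schroedinger_pairD[OF assms]
  have e: "exp ((\<beta> y - t - c x y) / lam) = exp (- t / lam) * exp ((\<beta> y - c x y) / lam)"
    "exp ((\<alpha> x + t - c x y) / lam) = exp (t / lam) * exp ((\<alpha> x - c x y) / lam)" for x y
    by (simp_all add: diff_divide_distrib add_divide_distrib flip: exp_add)
  have k: "integrable (measure_pmf s) (\<lambda>y. exp ((\<beta> y - t - c x y) / lam))"
    "integrable (measure_pmf r) (\<lambda>x. exp ((\<alpha> x + t - c x y) / lam))" for x y
    unfolding e by (intro integrable_mult_right D)+
  have "T (\<lambda>y. \<beta> y - t) x = \<alpha> x + t" "flip.T (\<lambda>x. \<alpha> x + t) y = \<beta> y - t" for x y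
    using ctransform_shift[of lam s \<beta> c x "- t", OF lam D(3)]
      ctransform_shift[of lam r \<alpha> "\<lambda>y x. c x y" y t, OF lam D(4)]
    by (simp_all add: D(5,6))
  then have T: "(\<lambda>x. \<alpha> x + t) = T (\<lambda>y. \<beta> y - t)" "(\<lambda>y. \<beta> y - t) = flip.T (\<lambda>x. \<alpha> x + t)"
    by fastforce+
  have "integrable (measure_pmf r) (\<lambda>x. \<alpha> x + t)" "integrable (measure_pmf s) (\<lambda>y. \<beta> y - t)"
    using D(1,2) by simp_all
  with T k show ?thesis
    unfolding schroedinger_pair_def by blast
qed

lemma normalized_schroedinger_pair:
  obtains \<alpha> \<beta> where "schroedinger_pair \<alpha> \<beta>"
    and "measure_pmf.expectation r \<alpha> = measure_pmf.expectation s \<beta>"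
    and "measure_pmf.expectation r \<alpha> \<ge> lower_mean"
proof -
  obtain \<alpha> \<beta> where sp: "schroedinger_pair \<alpha> \<beta>"
    and ge: "measure_pmf.expectation r \<alpha> + measure_pmf.expectation s \<beta> \<ge> 2 * lower_mean"
    by (rule schroedinger_pair_exists)
  define t where "t = (measure_pmf.expectation s \<beta> - measure_pmf.expectation r \<alpha>) / 2"
  have "measure_pmf.expectation r (\<lambda>x. \<alpha> x + t) = measure_pmf.expectation r \<alpha> + t"
    "measure_pmf.expectation s (\<lambda>y. \<beta> y - t) = measure_pmf.expectation s \<beta> - t"
    using schroedinger_pairD(1,2)[OF sp] by simp_all
  moreover have "measure_pmf.expectation r \<alpha> + t = measure_pmf.expectation s \<beta> - t"
    by (simp add: t_def field_simps)
  moreover have "measure_pmf.expectation r \<alpha> + t \<ge> lower_mean"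
    using ge by (simp add: t_def field_simps)
  ultimately show ?thesis
    using that[OF schroedinger_pair_shift[OF sp, of t]] by presburger
qed

end

subsection \<open>Extended sums and couplings\<close>

lemma ext_sum_integrable:
  assumes "integrable (count_space UNIV) f"
  shows "ext_sum f = ereal (integral\<^sup>L (count_space UNIV) f)"
proof -
  obtain a b where a: "(\<integral>\<^sup>+ i. ennreal (f i) \<partial>count_space UNIV) = ennreal a" "a \<ge> 0"
    and b: "(\<integral>\<^sup>+ i. ennreal (- f i) \<partial>count_space UNIV) = ennreal b" "b \<ge> 0"
    using real_integrable_def[THEN iffD1, OF assms] by (metis ennreal_enn2real_if enn2real_nonneg infinity_ennreal_def)
  then show ?thesis
    using real_lebesgue_integral_def[OF assms] by (simp add: ext_sum_def)
qed

text \<open>A summable bound on the negative parts excludes the indeterminate case, so summability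
  can fail only through the positive parts.\<close>

lemma ext_sum_infinite:
  assumes "\<not> integrable (count_space UNIV) f" and g: "integrable (count_space UNIV) g"
    and le: "\<And>i. - f i \<le> g i"
  shows "ext_sum f = \<infinity>"
proof -
  have "(\<integral>\<^sup>+ i. ennreal (- f i) \<partial>count_space UNIV) \<le> (\<integral>\<^sup>+ i. ennreal (g i) \<partial>count_space UNIV)"
    by (intro nn_integral_mono ennreal_leI le)
  also have "\<dots> < \<infinity>"
    using real_integrable_def[THEN iffD1, OF g] by (simp add: top.not_eq_extremum)
  finally have fin: "(\<integral>\<^sup>+ i. ennreal (- f i) \<partial>count_space UNIV) \<noteq> \<infinity>" by simp
  then have "(\<integral>\<^sup>+ i. ennreal (f i) \<partial>count_space UNIV) = \<infinity>"
    using assms(1) by (auto simp: real_integrable_def)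
  moreover obtain b where "(\<integral>\<^sup>+ i. ennreal (- f i) \<partial>count_space UNIV) = ennreal b" "b \<ge> 0"
    using fin by (metis ennreal_enn2real_if enn2real_nonneg infinity_ennreal_def)
  ultimately show ?thesis by (simp add: ext_sum_def)
qed

lemma
  fixes f :: "'i \<Rightarrow> real"
  shows integrable_count_space_pmf:
      "integrable (count_space UNIV) (\<lambda>i. pmf p i * f i) \<longleftrightarrow> integrable (measure_pmf p) f"
    and integral_count_space_pmf:
      "integral\<^sup>L (count_space UNIV) (\<lambda>i. pmf p i * f i) = measure_pmf.expectation p f"
  by (simp_all add: measure_pmf_eq_density integrable_density integral_density)

lemma
  shows integrable_pmf: "integrable (count_space UNIV) (pmf p)"
    and integral_pmf: "integral\<^sup>L (count_space UNIV) (pmf p) = 1"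
  using integrable_count_space_pmf[of p "\<lambda>_. 1"] integral_count_space_pmf[of p "\<lambda>_. 1"] by simp_all

lemma
  fixes f :: "'a \<Rightarrow> real" and g :: "'b \<Rightarrow> real"
  assumes "\<pi> \<in> couplings r s"
  shows coupling_integrable_fst: "integrable (measure_pmf r) f \<Longrightarrow> integrable (measure_pmf \<pi>) (\<lambda>z. f (fst z))"
    and coupling_integrable_snd: "integrable (measure_pmf s) g \<Longrightarrow> integrable (measure_pmf \<pi>) (\<lambda>z. g (snd z))"
    and coupling_expectation_fst: "measure_pmf.expectation \<pi> (\<lambda>z. f (fst z)) = measure_pmf.expectation r f"
    and coupling_expectation_snd: "measure_pmf.expectation \<pi> (\<lambda>z. g (snd z)) = measure_pmf.expectation s g"
    and coupling_pmf_eq_0: "pmf r x * pmf s y = 0 \<Longrightarrow> pmf \<pi> (x, y) = 0"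
proof -
  have *: "r = map_pmf fst \<pi>" "s = map_pmf snd \<pi>"
    using assms by (auto simp: couplings_def)
  show "integrable (measure_pmf r) f \<Longrightarrow> integrable (measure_pmf \<pi>) (\<lambda>z. f (fst z))"
    "integrable (measure_pmf s) g \<Longrightarrow> integrable (measure_pmf \<pi>) (\<lambda>z. g (snd z))"
    "measure_pmf.expectation \<pi> (\<lambda>z. f (fst z)) = measure_pmf.expectation r f"
    "measure_pmf.expectation \<pi> (\<lambda>z. g (snd z)) = measure_pmf.expectation s g"
    by (simp_all add: *)
  show "pmf \<pi> (x, y) = 0" if "pmf r x * pmf s y = 0"
  proof (rule ccontr)
    assume "pmf \<pi> (x, y) \<noteq> 0"
    then have "(x, y) \<in> set_pmf \<pi>" by (simp add: set_pmf_iff)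
    then have "x \<in> set_pmf r" "y \<in> set_pmf s" by (force simp: *)+
    with that show False by (simp add: set_pmf_iff)
  qed
qed

text \<open>This is the summand of the relative entropy of \<open>q\<close> with respect to
  \<open>exp u * w\<close>, with both masses included. For \<open>q > 0\<close> and
  \<open>t = exp u * w / q\<close> it equals \<open>q * (t - 1 - ln t)\<close>; for
  \<open>q = 0\<close> it is the positive number \<open>exp u * w\<close>.\<close>

lemma entropy_gap:
  fixes q u w :: real
  assumes "q \<ge> 0" "w > 0"
  shows "q * ln (q / w) - u * q - q + exp u * w \<ge> 0"
    and "q * ln (q / w) - u * q - q + exp u * w = 0 \<longleftrightarrow> q = exp u * w"
proof -
  have "q * ln (q / w) - u * q - q + exp u * w \<ge> 0 \<and>
     (q * ln (q / w) - u * q - q + exp u * w = 0 \<longleftrightarrow> q = exp u * w)"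
  proof (cases "q = 0")
    case False
    with assms have q: "q > 0" by simp
    define t where "t = exp u * w / q"
    have t: "t > 0" using q assms by (simp add: t_def)
    have u: "u = ln t + ln (q / w)"
      using q assms by (simp add: t_def ln_mult ln_div)
    have ew: "exp u * w = q * t"
      using q by (simp add: t_def)
    then have eq: "q * ln (q / w) - u * q - q + exp u * w = q * (t - 1 - ln t)"
      unfolding ew by (subst u) (simp add: algebra_simps)
    have "t - 1 - ln t \<ge> 0" using ln_le_minus_one[OF t] by simp
    moreover have "t - 1 - ln t = 0 \<longleftrightarrow> t = 1" using ln_eq_minus_one[OF t] by auto
    moreover have "t = 1 \<longleftrightarrow> q = exp u * w" using q by (auto simp: t_def field_simps)
    ultimately show ?thesis unfolding eq using q by auto
  qed (use assms in auto)
  then show "q * ln (q / w) - u * q - q + exp u * w \<ge> 0"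
    "q * ln (q / w) - u * q - q + exp u * w = 0 \<longleftrightarrow> q = exp u * w" by auto
qed

subsection \<open>Duality\<close>

context dominated_cost
begin

abbreviation gibbs :: "('a \<Rightarrow> real) \<Rightarrow> ('b \<Rightarrow> real) \<Rightarrow> 'a \<times> 'b \<Rightarrow> real" where
  "gibbs \<alpha> \<beta> \<equiv> \<lambda>(x, y). exp ((\<alpha> x + \<beta> y - c x y) / lam) * (pmf r x * pmf s y)"

text \<open>By the Schroedinger equations the exponential density integrates to 1 over each variable
  separately. This gives total mass 1 and, on testing against indicators of points, both
  marginals.\<close>

lemma schroedinger_plan:
  assumes sp: "schroedinger_pair \<alpha> \<beta>"
  obtains \<pi> where "\<pi> \<in> couplings r s" and "\<And>z. pmf \<pi> z = gibbs \<alpha> \<beta> z"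
proof -
  note D = schroedinger_pairD[OF sp]
  let ?e = "\<lambda>x y. exp ((\<alpha> x + \<beta> y - c x y) / lam)"
  have e: "?e x y = exp (\<alpha> x / lam) * exp ((\<beta> y - c x y) / lam)"
    "?e x y = exp (\<beta> y / lam) * exp ((\<alpha> x - c x y) / lam)" for x y
    by (simp_all add: diff_divide_distrib add_divide_distrib flip: exp_add)
  have "integrable (measure_pmf s) (\<lambda>y. ?e x y)" for x
    unfolding e(1) by (intro integrable_mult_right D)
  moreover have "measure_pmf.expectation s (\<lambda>y. ?e x y) = 1" for x
    using expectation_exp_diff_ctransform[of lam s \<beta> c x "\<alpha> x", OF lam D(3)] by (simp add: D(5))
  ultimately have es: "(\<integral>\<^sup>+y. ennreal (?e x y) \<partial>measure_pmf s) = 1" for x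
    by (simp add: nn_integral_eq_integral)
  have "integrable (measure_pmf r) (\<lambda>x. ?e x y)" for y
    unfolding e(2) by (intro integrable_mult_right D)
  moreover have "measure_pmf.expectation r (\<lambda>x. ?e x y) = 1" for y
    using expectation_exp_diff_ctransform[of lam r \<alpha> "\<lambda>y x. c x y" y "\<beta> y", OF lam D(4)]
    by (simp add: D(6) add.commute)
  ultimately have er: "(\<integral>\<^sup>+x. ennreal (?e x y) \<partial>measure_pmf r) = 1" for y
    by (simp add: nn_integral_eq_integral)
  \<comment> \<open>An arbitrary test function \<open>h\<close> is allowed, so that one computation
    serves the total mass and both marginals.\<close>
  have nn: "(\<integral>\<^sup>+z. ennreal (gibbs \<alpha> \<beta> z) * h z \<partial>count_space UNIV) =
      (\<integral>\<^sup>+x. \<integral>\<^sup>+y. ennreal (?e x y) * h (x, y) \<partial>measure_pmf s \<partial>measure_pmf r)" for h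
  proof -
    have "(\<integral>\<^sup>+z. ennreal (gibbs \<alpha> \<beta> z) * h z \<partial>count_space UNIV) =
      (\<integral>\<^sup>+z. ennreal (pmf (pair_pmf r s) z) * (ennreal (?e (fst z) (snd z)) * h z) \<partial>count_space UNIV)"
      by (intro nn_integral_cong) (auto simp: pmf_pair ennreal_mult' mult_ac)
    also have "\<dots> = (\<integral>\<^sup>+z. ennreal (?e (fst z) (snd z)) * h z \<partial>measure_pmf (pair_pmf r s))"
      by (rule nn_integral_measure_pmf[symmetric])
    also have "\<dots> = (\<integral>\<^sup>+x. \<integral>\<^sup>+y. ennreal (?e x y) * h (x, y) \<partial>measure_pmf s \<partial>measure_pmf r)"
      by (simp add: nn_integral_pair_pmf')
    finally show ?thesis .
  qed
  define \<pi> where "\<pi> = embed_pmf (gibbs \<alpha> \<beta>)"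
  have \<pi>: "pmf \<pi> z = gibbs \<alpha> \<beta> z" for z
    unfolding \<pi>_def
  proof (rule pmf_embed_pmf)
    show "(\<integral>\<^sup>+z. ennreal (gibbs \<alpha> \<beta> z) \<partial>count_space UNIV) = 1"
      using nn[of "\<lambda>_. 1"] by (simp add: es)
  qed auto
  have nn\<pi>: "(\<integral>\<^sup>+z. h z \<partial>measure_pmf \<pi>) =
      (\<integral>\<^sup>+x. \<integral>\<^sup>+y. ennreal (?e x y) * h (x, y) \<partial>measure_pmf s \<partial>measure_pmf r)" for h
    unfolding nn_integral_measure_pmf[of \<pi>] \<pi> by (rule nn)
  have "map_pmf fst \<pi> = r"
  proof (rule pmf_eqI)
    fix x
    have "ennreal (pmf (map_pmf fst \<pi>) x) = (\<integral>\<^sup>+z. indicator {x} (fst z) \<partial>measure_pmf \<pi>)"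
      by (simp add: ennreal_pmf_map indicator_vimage[symmetric])
    also have "\<dots> = (\<integral>\<^sup>+x'. indicator {x} x' \<partial>measure_pmf r)"
      by (simp add: nn\<pi> nn_integral_multc es)
    also have "\<dots> = ennreal (pmf r x)"
      by (simp add: emeasure_pmf_single)
    finally show "pmf (map_pmf fst \<pi>) x = pmf r x" by simp
  qed
  moreover have "map_pmf snd \<pi> = s"
  proof (rule pmf_eqI)
    fix y
    have "ennreal (pmf (map_pmf snd \<pi>) y) = (\<integral>\<^sup>+z. indicator {y} (snd z) \<partial>measure_pmf \<pi>)"
      by (simp add: ennreal_pmf_map indicator_vimage[symmetric])
    also have "\<dots> = (\<integral>\<^sup>+y'. \<integral>\<^sup>+x. ennreal (?e x y') * indicator {y} y' \<partial>measure_pmf r \<partial>measure_pmf s)"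
      unfolding nn\<pi> by (subst nn_integral_pmf_swap) simp
    also have "\<dots> = (\<integral>\<^sup>+y'. indicator {y} y' \<partial>measure_pmf s)"
      by (simp add: nn_integral_multc er)
    also have "\<dots> = ennreal (pmf s y)"
      by (simp add: emeasure_pmf_single)
    finally show "pmf (map_pmf snd \<pi>) y = pmf s y" by simp
  qed
  ultimately show ?thesis using \<pi> by (intro that[of \<pi>]) (auto simp: couplings_def)
qed

text \<open>The dominating functions depend on one variable each and are therefore integrable under
  every coupling. Only the entropy can make the primal objective infinite.\<close>

lemma integrable_cost:
  assumes "\<pi> \<in> couplings r s"
  shows "integrable (measure_pmf \<pi>) (\<lambda>z. c (fst z) (snd z))"
proof (rule integrable_between)
  show "integrable (measure_pmf \<pi>) (\<lambda>z. cXm (fst z) + cYm (snd z))"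
    by (intro Bochner_Integration.integrable_add coupling_integrable_fst[OF assms flip.int_cYm]
        coupling_integrable_snd[OF assms int_cYm])
  show "integrable (measure_pmf \<pi>) (\<lambda>z. cXp (fst z) + cYp (snd z))"
    by (intro Bochner_Integration.integrable_add coupling_integrable_fst[OF assms flip.int_cYp]
        coupling_integrable_snd[OF assms int_cYp])
qed (use lower upper in auto)

section \<open>Primal optimality of the Gibbs plan\<close>

lemma
  assumes sp: "schroedinger_pair \<alpha> \<beta>" and \<pi>: "\<pi> \<in> couplings r s"
  shows EROT_objective_ge:
      "EROT_objective c lam r s \<pi> \<ge> ereal (measure_pmf.expectation r \<alpha> + measure_pmf.expectation s \<beta>)"
    and EROT_objective_eq_iff:
      "EROT_objective c lam r s \<pi> = ereal (measure_pmf.expectation r \<alpha> + measure_pmf.expectation s \<beta>)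
        \<longleftrightarrow> (\<forall>z. pmf \<pi> z = gibbs \<alpha> \<beta> z)"
proof -
  let ?M = "count_space (UNIV :: ('a \<times> 'b) set)"
  let ?v = "measure_pmf.expectation r \<alpha> + measure_pmf.expectation s \<beta>"
  note D = schroedinger_pairD[OF sp]
  obtain p where p: "p \<in> couplings r s" "\<And>z. pmf p z = gibbs \<alpha> \<beta> z"
    by (rule schroedinger_plan[OF sp]) blast
  let ?f = "\<lambda>z. pmf \<pi> z * ln (pmf \<pi> z / (pmf r (fst z) * pmf s (snd z)))"
  let ?s = "\<lambda>z. \<alpha> (fst z) + \<beta> (snd z)"
  let ?c = "\<lambda>z. c (fst z) (snd z)"
  \<comment> \<open>\<open>h\<close> is \<open>lam\<close> times the expression of
    \<open>entropy_gap\<close> with \<open>w = pmf r x * pmf s y\<close> and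
    \<open>u = (\<alpha> x + \<beta> y - c x y) / lam\<close>. In its sum the two mass terms cancel,
    which leaves the objective minus \<open>?v\<close>.\<close>
  define h where "h z = pmf \<pi> z * ?c z + lam * ?f z - pmf \<pi> z * ?s z - lam * pmf \<pi> z + lam * pmf p z" for z
  have h: "h z \<ge> 0 \<and> (h z = 0 \<longleftrightarrow> pmf \<pi> z = pmf p z)" for z
  proof -
    obtain x y where z: "z = (x, y)" by (cases z)
    define w where "w = pmf r x * pmf s y"
    define u where "u = (\<alpha> x + \<beta> y - c x y) / lam"
    define g where "g = pmf \<pi> z * ln (pmf \<pi> z / w) - u * pmf \<pi> z - pmf \<pi> z + exp u * w"
    have u: "lam * u = \<alpha> x + \<beta> y - c x y" using lam by (simp add: u_def)
    have "h z = lam * (pmf \<pi> z * ln (pmf \<pi> z / w)) - (lam * u) * pmf \<pi> z - lam * pmf \<pi> z + lam * (exp u * w)"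
      unfolding h_def p(2) u unfolding z by (simp add: w_def u_def algebra_simps)
    then have hg: "h z = lam * g" by (simp add: g_def algebra_simps)
    have pz: "pmf p z = exp u * w" by (simp add: p(2) z u_def w_def)
    show ?thesis
    proof (cases "w = 0")
      \<comment> \<open>Here the quotient in the logarithm has denominator 0, but the coupling
        vanishes as well, so the term is 0.\<close>
      case True
      then have "pmf \<pi> z = 0" using coupling_pmf_eq_0[OF \<pi>] z w_def by simp
      then show ?thesis using True by (simp add: hg pz g_def)
    next
      case False
      then have "w > 0" using w_def by (simp add: less_le)
      then show ?thesis
        using entropy_gap[of "pmf \<pi> z" w u] lam by (simp add: hg pz g_def)
    qed
  qed
  have int_s: "integrable (measure_pmf \<pi>) ?s" "measure_pmf.expectation \<pi> ?s = ?v"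
    using coupling_integrable_fst[OF \<pi> D(1)] coupling_integrable_snd[OF \<pi> D(2)]
      coupling_expectation_fst[OF \<pi>, of \<alpha>] coupling_expectation_snd[OF \<pi>, of \<beta>] by simp_all
  have int_sM: "integrable ?M (\<lambda>z. pmf \<pi> z * ?s z)" "integral\<^sup>L ?M (\<lambda>z. pmf \<pi> z * ?s z) = ?v"
    using int_s integrable_count_space_pmf[of \<pi> ?s] integral_count_space_pmf[of \<pi> ?s] by simp_all
  have int_cM: "integrable ?M (\<lambda>z. pmf \<pi> z * ?c z)"
    using integrable_cost[OF \<pi>] integrable_count_space_pmf[of \<pi> ?c] by simp
  have f_eq: "(\<lambda>(x, y). pmf \<pi> (x, y) * ln (pmf \<pi> (x, y) / (pmf r x * pmf s y))) = ?f"
    "(\<lambda>(x, y). c x y * pmf \<pi> (x, y)) = (\<lambda>z. pmf \<pi> z * ?c z)"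
    by (auto simp: mult.commute)
  have obj: "EROT_objective c lam r s \<pi> = ereal (integral\<^sup>L ?M (\<lambda>z. pmf \<pi> z * ?c z)) + ereal lam * ext_sum ?f"
    unfolding EROT_objective_def rel_entropy_def f_eq by (simp add: ext_sum_integrable[OF int_cM])
  have "EROT_objective c lam r s \<pi> \<ge> ereal ?v \<and>
    (EROT_objective c lam r s \<pi> = ereal ?v \<longleftrightarrow> (\<forall>z. pmf \<pi> z = pmf p z))"
  proof (cases "integrable ?M ?f")
    case True
    have int_h: "integrable ?M h"
      unfolding h_def
      by (intro Bochner_Integration.integrable_add Bochner_Integration.integrable_diff
          integrable_mult_right True int_sM(1) int_cM integrable_pmf)
    have "integral\<^sup>L ?M h = integral\<^sup>L ?M (\<lambda>z. pmf \<pi> z * ?c z) + lam * integral\<^sup>L ?M ?f - ?v"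
      unfolding h_def using True int_sM int_cM integrable_pmf[of \<pi>] integrable_pmf[of p] by (simp add: integral_pmf)
    then have "EROT_objective c lam r s \<pi> = ereal (?v + integral\<^sup>L ?M h)"
      unfolding obj by (simp add: ext_sum_integrable[OF True])
    moreover have "integral\<^sup>L ?M h \<ge> 0"
      using h by (simp add: Bochner_Integration.integral_nonneg)
    moreover have "integral\<^sup>L ?M h = 0 \<longleftrightarrow> (\<forall>z. pmf \<pi> z = pmf p z)"
      using integral_nonneg_eq_0_iff_AE[OF int_h] h by (simp add: AE_count_space)
    ultimately show ?thesis by simp
  next
    case False
    \<comment> \<open>\<open>entropy_gap\<close> at \<open>u = 0\<close> bounds the negative parts
      by the product measure, so a nonsummable entropy is infinite.\<close>
    have "- ?f z \<le> pmf (pair_pmf r s) z" for z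
    proof -
      obtain x y where z: "z = (x, y)" by (cases z)
      show ?thesis
      proof (cases "pmf r x * pmf s y = 0")
        case True
        then show ?thesis using coupling_pmf_eq_0[OF \<pi> True] z by simp
      next
        case False
        then have "pmf r x * pmf s y > 0" by (simp add: less_le)
        then show ?thesis
          using entropy_gap(1)[of "pmf \<pi> (x, y)" "pmf r x * pmf s y" 0] pmf_nonneg[of \<pi> "(x, y)"]
          unfolding z pmf_pair fst_conv snd_conv exp_zero by linarith
      qed
    qed
    then have "ext_sum ?f = \<infinity>"
      by (rule ext_sum_infinite[OF False integrable_pmf])
    then have "EROT_objective c lam r s \<pi> = \<infinity>"
      unfolding obj using lam by simp
    moreover have "\<not> (\<forall>z. pmf \<pi> z = pmf p z)"
    proof
      \<comment> \<open>The Gibbs plan has summable entropy terms, because its log density is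
        \<open>(?s z - ?c z) / lam\<close> wherever the product measure is positive; so it cannot
        occur in this case.\<close>
      assume eq: "\<forall>z. pmf \<pi> z = pmf p z"
      have "?f z = (pmf \<pi> z * ?s z - pmf \<pi> z * ?c z) / lam" for z
      proof (cases "pmf r (fst z) * pmf s (snd z) = 0")
        case True
        then have "pmf \<pi> z = 0" using eq[rule_format, of z] by (simp add: p(2) split_beta)
        then show ?thesis by simp
      next
        case False
        then have "ln (pmf \<pi> z / (pmf r (fst z) * pmf s (snd z))) = (?s z - ?c z) / lam"
          using eq[rule_format, of z] by (simp add: p(2) split_beta)
        then show ?thesis by (simp add: right_diff_distrib)
      qed
      moreover have "integrable ?M (\<lambda>z. (pmf \<pi> z * ?s z - pmf \<pi> z * ?c z) / lam)"
        by (intro integrable_divide Bochner_Integration.integrable_diff int_sM(1) int_cM)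
      ultimately show False using False by presburger
    qed
    ultimately show ?thesis by simp
  qed
  then show "EROT_objective c lam r s \<pi> \<ge> ereal ?v"
    "EROT_objective c lam r s \<pi> = ereal ?v \<longleftrightarrow> (\<forall>z. pmf \<pi> z = gibbs \<alpha> \<beta> z)"
    by (auto simp: p(2))
qed

lemma
  assumes sp: "schroedinger_pair \<alpha> \<beta>"
  shows EROT_eq: "EROT c lam r s = ereal (measure_pmf.expectation r \<alpha> + measure_pmf.expectation s \<beta>)"
    and is_EROT_plan_iff: "is_EROT_plan c lam r s \<pi> \<longleftrightarrow> (\<forall>z. pmf \<pi> z = gibbs \<alpha> \<beta> z)"
    and ex1_EROT_plan: "\<exists>!\<pi>. is_EROT_plan c lam r s \<pi>"
proof -
  let ?v = "ereal (measure_pmf.expectation r \<alpha> + measure_pmf.expectation s \<beta>)"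
  obtain p where p: "p \<in> couplings r s" "\<And>z. pmf p z = gibbs \<alpha> \<beta> z"
    by (rule schroedinger_plan[OF sp]) blast
  have p_obj: "EROT_objective c lam r s p = ?v"
    using EROT_objective_eq_iff[OF sp p(1)] p(2) by simp
  show "EROT c lam r s = ?v"
    unfolding EROT_def
    by (rule antisym) (use p(1) p_obj in \<open>auto intro!: INF_lower2[of p] INF_greatest EROT_objective_ge[OF sp]\<close>)
  show iff: "is_EROT_plan c lam r s \<pi> \<longleftrightarrow> (\<forall>z. pmf \<pi> z = gibbs \<alpha> \<beta> z)" for \<pi>
  proof
    assume "is_EROT_plan c lam r s \<pi>"
    then have "\<pi> \<in> couplings r s" "\<not> EROT_objective c lam r s p < EROT_objective c lam r s \<pi>"
      using p(1) by (auto simp: is_EROT_plan_def is_arg_min_def)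
    then show "\<forall>z. pmf \<pi> z = gibbs \<alpha> \<beta> z"
      using EROT_objective_ge[OF sp, of \<pi>] EROT_objective_eq_iff[OF sp, of \<pi>] p_obj
      by (simp add: not_less antisym)
  next
    assume "\<forall>z. pmf \<pi> z = gibbs \<alpha> \<beta> z"
    then have "\<pi> = p" using p(2) by (intro pmf_eqI) metis
    then show "is_EROT_plan c lam r s \<pi>"
      using p(1) p_obj EROT_objective_ge[OF sp] by (auto simp: is_EROT_plan_def is_arg_min_def not_less)
  qed
  show "\<exists>!\<pi>. is_EROT_plan c lam r s \<pi>"
  proof (rule ex1I)
    show "is_EROT_plan c lam r s p" unfolding iff using p(2) by blast
    show "\<pi> = p" if "is_EROT_plan c lam r s \<pi>" for \<pi>
      using that p(2) unfolding iff by (intro pmf_eqI) metis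
  qed
qed

section \<open>Dual optimality of Schroedinger pairs\<close>

lemma
  assumes sp: "schroedinger_pair \<alpha> \<beta>"
    and \<alpha>': "integrable (measure_pmf r) \<alpha>'" and \<beta>': "integrable (measure_pmf s) \<beta>'"
  shows EROT_dual_le:
      "EROT_dual c lam r s \<alpha>' \<beta>' \<le> ereal (measure_pmf.expectation r \<alpha> + measure_pmf.expectation s \<beta>)"
    and EROT_dual_eqD:
      "EROT_dual c lam r s \<alpha>' \<beta>' = ereal (measure_pmf.expectation r \<alpha> + measure_pmf.expectation s \<beta>)
        \<Longrightarrow> x \<in> set_pmf r \<Longrightarrow> y \<in> set_pmf s \<Longrightarrow> \<alpha>' x + \<beta>' y = \<alpha> x + \<beta> y"
    and EROT_dual_schroedinger:
      "EROT_dual c lam r s \<alpha> \<beta> = ereal (measure_pmf.expectation r \<alpha> + measure_pmf.expectation s \<beta>)"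
proof -
  let ?M = "count_space (UNIV :: ('a \<times> 'b) set)"
  let ?v = "measure_pmf.expectation r \<alpha> + measure_pmf.expectation s \<beta>"
  let ?v' = "measure_pmf.expectation r \<alpha>' + measure_pmf.expectation s \<beta>'"
  note D = schroedinger_pairD[OF sp]
  obtain p where p: "p \<in> couplings r s" "\<And>z. pmf p z = gibbs \<alpha> \<beta> z"
    by (rule schroedinger_plan[OF sp]) blast
  let ?d = "\<lambda>z. \<alpha>' (fst z) + \<beta>' (snd z) - (\<alpha> (fst z) + \<beta> (snd z))"
  \<comment> \<open>With \<open>t = ?d z / lam\<close>, the density for \<open>\<alpha>'\<close> and
    \<open>\<beta>'\<close> is \<open>pmf p z * exp t\<close>, so
    \<open>h z = pmf p z * (exp t - 1 - t)\<close>. As \<open>p\<close> is a coupling,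
    \<open>?d\<close> has mean \<open>?v' - ?v\<close>, and \<open>lam\<close> times the sum of
    \<open>h\<close> is the dual deficit.\<close>
  define h where "h z = gibbs \<alpha>' \<beta>' z - pmf p z - pmf p z * ?d z / lam" for z
  have h_eq: "h z = pmf p z * (exp (?d z / lam) - 1 - ?d z / lam)" for z
    by (cases z) (simp add: h_def p(2) algebra_simps diff_divide_distrib add_divide_distrib flip: exp_add)
  have h: "h z \<ge> 0" for z
    unfolding h_eq using exp_ge_add_one_self[of "?d z / lam"] by (intro mult_nonneg_nonneg pmf_nonneg) linarith
  have "integrable (measure_pmf p) ?d" "measure_pmf.expectation p ?d = ?v' - ?v"
    using coupling_integrable_fst[OF p(1) D(1)] coupling_integrable_snd[OF p(1) D(2)]
      coupling_expectation_fst[OF p(1), of \<alpha>] coupling_expectation_snd[OF p(1), of \<beta>]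
      coupling_integrable_fst[OF p(1) \<alpha>'] coupling_integrable_snd[OF p(1) \<beta>']
      coupling_expectation_fst[OF p(1), of \<alpha>'] coupling_expectation_snd[OF p(1), of \<beta>'] by simp_all
  then have int_d: "integrable ?M (\<lambda>z. pmf p z * ?d z)" "integral\<^sup>L ?M (\<lambda>z. pmf p z * ?d z) = ?v' - ?v"
    using integrable_count_space_pmf[of p ?d] integral_count_space_pmf[of p ?d] by simp_all
  have dual: "EROT_dual c lam r s a b = ereal (measure_pmf.expectation r a + measure_pmf.expectation s b)
      - ereal lam * ext_sum (\<lambda>z. gibbs a b z - pmf (pair_pmf r s) z)" for a b
    unfolding EROT_dual_def
    by (rule arg_cong[where f = "\<lambda>f. _ - ereal lam * ext_sum f"]) (auto simp: pmf_pair)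
  show "EROT_dual c lam r s \<alpha> \<beta> = ereal ?v"
  proof -
    have "(\<lambda>z. gibbs \<alpha> \<beta> z - pmf (pair_pmf r s) z) = (\<lambda>z. pmf p z - pmf (pair_pmf r s) z)"
      by (simp add: p(2))
    moreover have "ext_sum (\<lambda>z. pmf p z - pmf (pair_pmf r s) z) = 0"
      using integrable_pmf[of p] integrable_pmf[of "pair_pmf r s"]
      by (subst ext_sum_integrable) (simp_all add: integral_pmf)
    ultimately show ?thesis unfolding dual by simp
  qed
  have *: "EROT_dual c lam r s \<alpha>' \<beta>' \<le> ereal ?v \<and>
    (EROT_dual c lam r s \<alpha>' \<beta>' = ereal ?v \<longrightarrow> (\<forall>z. h z = 0))"
  proof (cases "integrable ?M (gibbs \<alpha>' \<beta>')")
    case True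
    have int_h: "integrable ?M h"
      unfolding h_def
      by (intro Bochner_Integration.integrable_diff integrable_divide True int_d(1) integrable_pmf)
    have "integral\<^sup>L ?M h = integral\<^sup>L ?M (gibbs \<alpha>' \<beta>') - 1 - (?v' - ?v) / lam"
      unfolding h_def using True integrable_pmf[of p] int_d by (simp add: integral_pmf)
    then have v: "?v' - lam * (integral\<^sup>L ?M (gibbs \<alpha>' \<beta>') - 1) = ?v - lam * integral\<^sup>L ?M h"
      using lam by (simp add: field_simps)
    have "ext_sum (\<lambda>z. gibbs \<alpha>' \<beta>' z - pmf (pair_pmf r s) z) = ereal (integral\<^sup>L ?M (gibbs \<alpha>' \<beta>') - 1)"
      using True integrable_pmf[of "pair_pmf r s"] by (subst ext_sum_integrable) (simp_all add: integral_pmf)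
    then have "EROT_dual c lam r s \<alpha>' \<beta>' = ereal (?v - lam * integral\<^sup>L ?M h)"
      unfolding dual using v by simp
    moreover have "integral\<^sup>L ?M h \<ge> 0"
      using h by (simp add: Bochner_Integration.integral_nonneg)
    moreover have "integral\<^sup>L ?M h = 0 \<longleftrightarrow> (\<forall>z. h z = 0)"
      using integral_nonneg_eq_0_iff_AE[OF int_h] h by (simp add: AE_count_space)
    ultimately show ?thesis using lam by simp
  next
    case False
    \<comment> \<open>Subtracting the summable product measure cannot restore summability, and it
      bounds the negative parts; so the penalty is infinite.\<close>
    have "\<not> integrable ?M (\<lambda>z. gibbs \<alpha>' \<beta>' z - pmf (pair_pmf r s) z)"
    proof
      assume "integrable ?M (\<lambda>z. gibbs \<alpha>' \<beta>' z - pmf (pair_pmf r s) z)"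
      from Bochner_Integration.integrable_add[OF this integrable_pmf[of "pair_pmf r s"]] False
      show False by simp
    qed
    then have "ext_sum (\<lambda>z. gibbs \<alpha>' \<beta>' z - pmf (pair_pmf r s) z) = \<infinity>"
      by (rule ext_sum_infinite[OF _ integrable_pmf[of "pair_pmf r s"]]) (simp add: split_beta)
    then show ?thesis unfolding dual using lam by simp
  qed
  then show "EROT_dual c lam r s \<alpha>' \<beta>' \<le> ereal ?v" by simp
  assume "EROT_dual c lam r s \<alpha>' \<beta>' = ereal ?v" and xy: "x \<in> set_pmf r" "y \<in> set_pmf s"
  with * have "h (x, y) = 0" by blast
  \<comment> \<open>The Gibbs plan is positive on the product of the supports, so there the factor
    \<open>exp t - 1 - t\<close> itself must vanish.\<close>
  moreover have "pmf p (x, y) \<noteq> 0" using xy by (simp add: p(2) set_pmf_iff)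
  ultimately have "exp (?d (x, y) / lam) = 1 + ?d (x, y) / lam" by (simp add: h_eq)
  then have "?d (x, y) / lam = 0"
    by (metis exp_gt_zero ln_exp ln_eq_minus_one add_diff_cancel_left' exp_zero)
  then show "\<alpha>' x + \<beta>' y = \<alpha> x + \<beta> y" using lam by simp
qed

end

subsection \<open>Bounds and uniqueness\<close>

context half_dominated
begin

lemma exp_mean_gap_le:
  "exp ((measure_pmf.expectation s cYp - measure_pmf.expectation s cYm) / lam)
    \<le> measure_pmf.expectation s (exp_weight lam cYm cYp)"
proof -
  have "exp (measure_pmf.expectation s (\<lambda>y. (cYp y - cYm y) / lam))
    \<le> measure_pmf.expectation s (\<lambda>y. exp ((cYp y - cYm y) / lam))"
    by (rule exp_expectation_le) (use int_cYm int_cYp int_phi in \<open>simp_all add: exp_weight_def[abs_def]\<close>)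
  then show ?thesis
    using int_cYm int_cYp by (simp add: exp_weight_def[abs_def])
qed

text \<open>The logarithmic form of Jensen's inequality for the exponential weight. It absorbs the
  differences of means that remain when the bounds on both potentials are added.\<close>

lemma mean_gap_le:
  "measure_pmf.expectation s cYp - measure_pmf.expectation s cYm
    \<le> lam * ln (measure_pmf.expectation s (exp_weight lam cYm cYp))"
proof -
  have "(measure_pmf.expectation s cYp - measure_pmf.expectation s cYm) / lam
      \<le> ln (measure_pmf.expectation s (exp_weight lam cYm cYp))"
    using exp_mean_gap_le expectation_pos[OF int_phi] by (subst ln_ge_iff) auto
  then show ?thesis using lam by (simp add: field_simps)
qed

end

context dominated_cost
begin

lemma schroedinger_pair_bounds:
  assumes sp: "schroedinger_pair \<alpha> \<beta>"
    and eq: "measure_pmf.expectation r \<alpha> = measure_pmf.expectation s \<beta>"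
    and ge: "measure_pmf.expectation r \<alpha> \<ge> lower_mean"
  shows "\<alpha> x \<le> cXp x + measure_pmf.expectation s cYp - lower_mean"
    and "\<beta> y \<le> cYp y + measure_pmf.expectation r cXp - lower_mean"
    and "\<alpha> x \<ge> cXm x - measure_pmf.expectation r cXp + lower_mean
      - lam * ln (measure_pmf.expectation s (exp_weight lam cYm cYp))"
    and "\<beta> y \<ge> cYm y - measure_pmf.expectation s cYp + lower_mean
      - lam * ln (measure_pmf.expectation r (exp_weight lam cXm cXp))"
proof -
  note D = schroedinger_pairD[OF sp]
  show \<alpha>: "\<alpha> x \<le> cXp x + measure_pmf.expectation s cYp - lower_mean" for x
    using ctransform_le[OF D(3,2), of x] eq ge unfolding D(5) by linarith
  show \<beta>: "\<beta> y \<le> cYp y + measure_pmf.expectation r cXp - lower_mean" for y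
    using flip.ctransform_le[OF D(4,1), of y] ge unfolding D(6) by linarith
  \<comment> \<open>The upper bound on \<open>\<beta>\<close> is the hypothesis under which
    \<open>ctransform_ge\<close> bounds \<open>\<alpha> = T \<beta>\<close> from below; the last
    bound is symmetric.\<close>
  show "\<alpha> x \<ge> cXm x - measure_pmf.expectation r cXp + lower_mean
      - lam * ln (measure_pmf.expectation s (exp_weight lam cYm cYp))"
    using ctransform_ge[of \<beta> "measure_pmf.expectation r cXp - lower_mean" x] \<beta> unfolding D(5)
    by (simp add: algebra_simps)
  show "\<beta> y \<ge> cYm y - measure_pmf.expectation s cYp + lower_mean
      - lam * ln (measure_pmf.expectation r (exp_weight lam cXm cXp))"
    using flip.ctransform_ge[of \<alpha> "measure_pmf.expectation s cYp - lower_mean" y] \<alpha> unfolding D(6)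
    by (simp add: algebra_simps)
qed

lemma gibbs_bounds:
  assumes "schroedinger_pair \<alpha> \<beta>"
    and "measure_pmf.expectation r \<alpha> = measure_pmf.expectation s \<beta>"
    and "measure_pmf.expectation r \<alpha> \<ge> lower_mean"
  shows "gibbs \<alpha> \<beta> (x, y) \<le> pmf r x * pmf s y * (exp_weight lam cXm cXp x * exp_weight lam cYm cYp y
      * measure_pmf.expectation r (exp_weight lam cXm cXp) * measure_pmf.expectation s (exp_weight lam cYm cYp))"
    (is "_ \<le> _ * (?fx * ?fy * ?P * ?Q)")
    and "gibbs \<alpha> \<beta> (x, y) \<ge> pmf r x * pmf s y * inverse (exp_weight lam cXm cXp x * exp_weight lam cYm cYp y
      * (measure_pmf.expectation r (exp_weight lam cXm cXp))\<^sup>2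
      * (measure_pmf.expectation s (exp_weight lam cYm cYp))\<^sup>2)"
proof -
  note b = schroedinger_pair_bounds(1,3)[OF assms, of x] schroedinger_pair_bounds(2,4)[OF assms, of y]
  have m2: "2 * lower_mean = measure_pmf.expectation r cXm + measure_pmf.expectation s cYm"
    by (simp add: lower_mean_def)
  have pos: "?P > 0" "?Q > 0"
    by (simp_all add: expectation_pos int_phi flip.int_phi)
  define dx dy where "dx = cXp x - cXm x" and "dy = cYp y - cYm y"
  have fx: "?fx = exp (dx / lam)" "?fy = exp (dy / lam)"
    by (simp_all add: exp_weight_def dx_def dy_def)
  define u where "u = \<alpha> x + \<beta> y - c x y"
  have P: "exp (ln ?P) = ?P" "exp (ln ?Q) = ?Q" using pos by simp_all
  \<comment> \<open>Adding the upper bounds leaves the constant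
    \<open>E cXp + E cYp - 2 * lower_mean\<close>, the sum of the two mean gaps;
    \<open>mean_gap_le\<close> and its mirror image turn each gap into one logarithm.\<close>
  have "u \<le> dx + dy + lam * ln ?P + lam * ln ?Q"
    using b(1) b(3) lower[of x y] m2 mean_gap_le flip.mean_gap_le unfolding u_def dx_def dy_def by linarith
  then have "u / lam \<le> dx / lam + dy / lam + ln ?P + ln ?Q"
    using lam by (simp add: field_simps)
  then have "exp (u / lam) \<le> exp (dx / lam + dy / lam + ln ?P + ln ?Q)"
    by (subst exp_le_cancel_iff)
  then have "exp (u / lam) \<le> ?fx * ?fy * ?P * ?Q"
    unfolding fx exp_add P .
  then have "exp (u / lam) * (pmf r x * pmf s y) \<le> ?fx * ?fy * ?P * ?Q * (pmf r x * pmf s y)"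
    by (rule mult_right_mono) simp
  then show "gibbs \<alpha> \<beta> (x, y) \<le> pmf r x * pmf s y * (?fx * ?fy * ?P * ?Q)"
    by (simp add: u_def mult.commute)
  \<comment> \<open>The lower bounds on the potentials already contain one logarithm each, and each
    mean gap contributes another; this produces the squares.\<close>
  have "u \<ge> - (dx + dy + 2 * (lam * ln ?P) + 2 * (lam * ln ?Q))"
    using b(2) b(4) upper[of x y] m2 mean_gap_le flip.mean_gap_le unfolding u_def dx_def dy_def by linarith
  then have "- (dx + dy + 2 * (lam * ln ?P) + 2 * (lam * ln ?Q)) / lam \<le> u / lam"
    by (rule divide_right_mono) (use lam in simp)
  moreover have "- (dx + dy + 2 * (lam * ln ?P) + 2 * (lam * ln ?Q)) / lam =
      - (dx / lam + dy / lam + (ln ?P + ln ?P) + (ln ?Q + ln ?Q))"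
    using lam by (simp add: field_simps)
  ultimately have le: "- (dx / lam + dy / lam + (ln ?P + ln ?P) + (ln ?Q + ln ?Q)) \<le> u / lam"
    by simp
  have "inverse (?fx * ?fy * ?P\<^sup>2 * ?Q\<^sup>2) = exp (- (dx / lam + dy / lam + (ln ?P + ln ?P) + (ln ?Q + ln ?Q)))"
    unfolding fx exp_minus exp_add P power2_eq_square by (rule refl)
  also have "\<dots> \<le> exp (u / lam)"
    using le by (subst exp_le_cancel_iff)
  finally have "inverse (?fx * ?fy * ?P\<^sup>2 * ?Q\<^sup>2) * (pmf r x * pmf s y) \<le> exp (u / lam) * (pmf r x * pmf s y)"
    by (rule mult_right_mono) simp
  then show "gibbs \<alpha> \<beta> (x, y) \<ge> pmf r x * pmf s y * inverse (?fx * ?fy * ?P\<^sup>2 * ?Q\<^sup>2)"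
    by (simp add: u_def mult.commute)
qed

section \<open>Potentials and Schroedinger pairs\<close>

lemma EROT_potentials_schroedinger:
  assumes "schroedinger_pair \<alpha> \<beta>"
  shows "EROT_potentials c lam r s \<alpha> \<beta>"
proof -
  note D = schroedinger_pairD[OF assms]
  have "\<alpha> x = - lam * ln (measure_pmf.expectation s (\<lambda>y. exp ((\<beta> y - c x y) / lam)))"
    "\<beta> y = - lam * ln (measure_pmf.expectation r (\<lambda>x. exp ((\<alpha> x - c x y) / lam)))" for x y
    using D(5)[of x] D(6)[of y] unfolding ctransform_def by simp_all
  moreover have "is_arg_max (\<lambda>(\<alpha>, \<beta>). EROT_dual c lam r s \<alpha> \<beta>)
      (\<lambda>(\<alpha>, \<beta>). integrable (measure_pmf r) \<alpha> \<and> integrable (measure_pmf s) \<beta>) (\<alpha>, \<beta>)"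
    using D(1,2) EROT_dual_le[OF assms] EROT_dual_schroedinger[OF assms D(1,2)]
    by (auto simp: is_arg_max_def not_less)
  ultimately show ?thesis
    unfolding EROT_potentials_def using D(3,4) by blast
qed

text \<open>Two maximizers have the same sum \<open>\<alpha> x + \<beta> y\<close> on the product of
  the supports, so they differ there by opposite constants. The prescribed mean makes these
  constants zero.\<close>

lemma EROT_potentials_unique:
  assumes sp: "schroedinger_pair \<alpha> \<beta>" and pot: "EROT_potentials c lam r s \<alpha>' \<beta>'"
    and mean: "measure_pmf.expectation r \<alpha>' = measure_pmf.expectation r \<alpha>"
  shows "\<alpha>' = \<alpha>" and "\<beta>' = \<beta>"
proof -
  note D = schroedinger_pairD[OF sp]
  have int: "integrable (measure_pmf r) \<alpha>'" "integrable (measure_pmf s) \<beta>'"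
    and "\<not> EROT_dual c lam r s \<alpha>' \<beta>' < EROT_dual c lam r s \<alpha> \<beta>"
    using pot D(1,2) by (auto simp: EROT_potentials_def is_arg_max_def)
  then have "EROT_dual c lam r s \<alpha>' \<beta>' = ereal (measure_pmf.expectation r \<alpha> + measure_pmf.expectation s \<beta>)"
    using EROT_dual_le[OF sp int] EROT_dual_schroedinger[OF sp int] by (simp add: not_less antisym)
  then have sum: "\<alpha>' x + \<beta>' y = \<alpha> x + \<beta> y" if "x \<in> set_pmf r" "y \<in> set_pmf s" for x y
    using EROT_dual_eqD[OF sp int] that by blast
  obtain y0 where y0: "y0 \<in> set_pmf s" using set_pmf_not_empty[of s] by blast
  have "\<alpha>' x = \<alpha> x + (\<beta> y0 - \<beta>' y0)" if "x \<in> set_pmf r" for x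
    using sum[OF that y0] by linarith
  then have "measure_pmf.expectation r \<alpha>' = measure_pmf.expectation r (\<lambda>x. \<alpha> x + (\<beta> y0 - \<beta>' y0))"
    by (intro integral_cong_AE) (auto simp: AE_measure_pmf_iff)
  also have "\<dots> = measure_pmf.expectation r \<alpha> + (\<beta> y0 - \<beta>' y0)"
    using D(1) by simp
  finally have "\<beta> y0 = \<beta>' y0" using mean by simp
  then have \<alpha>: "\<alpha>' x = \<alpha> x" if "x \<in> set_pmf r" for x
    using sum[OF that y0] by linarith
  obtain x0 where x0: "x0 \<in> set_pmf r" using set_pmf_not_empty[of r] by blast
  have \<beta>: "\<beta>' y = \<beta> y" if "y \<in> set_pmf s" for y
    using sum[OF x0 that] \<alpha>[OF x0] by linarith
  \<comment> \<open>Off the support the convention makes the value a transform, which depends only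
    on the values on the other support, where equality is already known.\<close>
  have "\<alpha>' x = T \<beta>' x" if "x \<notin> set_pmf r" for x
    using pot that unfolding EROT_potentials_def ctransform_def by blast
  then show "\<alpha>' = \<alpha>"
    using \<alpha> ctransform_cong[of s \<beta>' \<beta> lam c, OF \<beta>] D(5) by (intro ext) metis
  have "\<beta>' y = flip.T \<alpha>' y" if "y \<notin> set_pmf s" for y
    using pot that unfolding EROT_potentials_def ctransform_def by blast
  then show "\<beta>' = \<beta>"
    using \<beta> ctransform_cong[of r \<alpha>' \<alpha> lam "\<lambda>y x. c x y", OF \<alpha>] D(6) by (intro ext) metis
qed

end

section \<open>Summability of the weights and assembly of the theorem\<close>

text \<open>Under a coupling, each function of a single variable is integrated against the
  corresponding marginal.\<close>

lemma coupling_weights_summable: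
  fixes f :: "'a \<Rightarrow> real" and g :: "'b \<Rightarrow> real"
  assumes "\<pi> \<in> couplings r s" "integrable (measure_pmf r) f" "integrable (measure_pmf s) g"
  shows "(\<lambda>(x, y). (f x + g y) * pmf \<pi> (x, y)) summable_on UNIV"
proof -
  have "integrable (measure_pmf \<pi>) (\<lambda>z. f (fst z) + g (snd z))"
    using coupling_integrable_fst[OF assms(1,2)] coupling_integrable_snd[OF assms(1,3)] by simp
  then have "integrable (count_space UNIV) (\<lambda>z. pmf \<pi> z * (f (fst z) + g (snd z)))"
    by (simp add: integrable_count_space_pmf)
  then have "Infinite_Set_Sum.abs_summable_on (\<lambda>z. pmf \<pi> z * (f (fst z) + g (snd z))) UNIV"
    by (simp add: Infinite_Set_Sum.abs_summable_on_def)
  then have "(\<lambda>z. pmf \<pi> z * (f (fst z) + g (snd z))) summable_on UNIV"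
    unfolding abs_summable_equivalent[symmetric] by (rule abs_summable_summable)
  then show ?thesis by (simp add: case_prod_unfold mult.commute)
qed

lemma integrable_weightD:
  assumes "integrable (measure_pmf p) (weight cm cp)"
  shows "integrable (measure_pmf p) cm" and "integrable (measure_pmf p) cp"
  by (rule Bochner_Integration.integrable_bound[OF assms]; simp add: weight_def)+

theorem proposition2p3:
  fixes c :: "'a::countable \<Rightarrow> 'b::countable \<Rightarrow> real" and lam m :: real
    and cXm cXp CX \<phi>X :: "'a \<Rightarrow> real" and cYm cYp CY \<phi>Y :: "'b \<Rightarrow> real"
    and r :: "'a pmf" and s :: "'b pmf"
  assumes "lam > 0"
    and "dominating c cXm cXp cYm cYp"
    and "CX = weight cXm cXp" and "CY = weight cYm cYp"
    and "\<phi>X = exp_weight lam cXm cXp" and "\<phi>Y = exp_weight lam cYm cYp"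
    and "integrable (measure_pmf r) CX" and "integrable (measure_pmf r) \<phi>X"
    and "integrable (measure_pmf s) CY" and "integrable (measure_pmf s) \<phi>Y"
    and "m = (measure_pmf.expectation r cXm + measure_pmf.expectation s cYm) / 2"
  shows "(\<exists>\<alpha> \<beta>.
      (EROT_potentials c lam r s \<alpha> \<beta> \<and>
       ereal (measure_pmf.expectation r \<alpha>) = EROT c lam r s / 2 \<and>
       ereal (measure_pmf.expectation s \<beta>) = EROT c lam r s / 2) \<and>
      (\<forall>\<alpha>' \<beta>'.
         EROT_potentials c lam r s \<alpha>' \<beta>' \<and>
         ereal (measure_pmf.expectation r \<alpha>') = EROT c lam r s / 2 \<and>
         ereal (measure_pmf.expectation s \<beta>') = EROT c lam r s / 2 \<longrightarrow> \<alpha>' = \<alpha> \<and> \<beta>' = \<beta>) \<and>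
      EROT c lam r s / 2 \<ge> ereal m \<and>
      (\<forall>x. cXm x - measure_pmf.expectation r cXp + m - lam * ln (measure_pmf.expectation s \<phi>Y) \<le> \<alpha> x
         \<and> \<alpha> x \<le> cXp x + measure_pmf.expectation s cYp - m) \<and>
      (\<forall>y. cYm y - measure_pmf.expectation s cYp + m - lam * ln (measure_pmf.expectation r \<phi>X) \<le> \<beta> y
         \<and> \<beta> y \<le> cYp y + measure_pmf.expectation r cXp - m)) \<and>
    (\<exists>!\<pi>. is_EROT_plan c lam r s \<pi>) \<and>
    (\<forall>\<pi>. is_EROT_plan c lam r s \<pi> \<longrightarrow>
      (\<forall>x y.
         pmf r x * pmf s y * inverse (\<phi>X x * \<phi>Y y
             * (measure_pmf.expectation r \<phi>X)\<^sup>2 * (measure_pmf.expectation s \<phi>Y)\<^sup>2) \<le> pmf \<pi> (x, y) \<and>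
         pmf \<pi> (x, y) \<le> pmf r x * pmf s y * (\<phi>X x * \<phi>Y y
             * measure_pmf.expectation r \<phi>X * measure_pmf.expectation s \<phi>Y)) \<and>
      (integrable (measure_pmf r) (\<lambda>x. CX x * \<phi>X x) \<and>
       integrable (measure_pmf s) (\<lambda>y. CY y * \<phi>Y y) \<longrightarrow>
         (\<lambda>(x, y). (CX x + CY y) * pmf \<pi> (x, y)) summable_on UNIV))"
proof -
  note dom = \<open>dominating c cXm cXp cYm cYp\<close>[unfolded dominating_def]
  note eqs = \<open>CX = weight cXm cXp\<close> \<open>CY = weight cYm cYp\<close>
    \<open>\<phi>X = exp_weight lam cXm cXp\<close> \<open>\<phi>Y = exp_weight lam cYm cYp\<close>
  interpret dominated_cost lam r s c cXm cXp cYm cYp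
  proof
    show "integrable (measure_pmf r) cXm" "integrable (measure_pmf r) cXp"
      "integrable (measure_pmf s) cYm" "integrable (measure_pmf s) cYp"
      using assms(7,9) unfolding eqs by (auto dest: integrable_weightD)
    show "cXm x + cYm y \<le> c x y" "c x y \<le> cXp x + cYp y" "cXm x \<le> cXp x" for x y
      using dom by auto
    show "cYm y + cXm x \<le> c x y" "c x y \<le> cYp y + cXp x" for x y
      using dom by (auto simp: add.commute)
  qed (use assms(1,8,10) in \<open>auto simp: eqs\<close>)
  have m: "m = lower_mean" using assms(11) by (simp add: lower_mean_def)
  obtain \<alpha> \<beta> where sp: "schroedinger_pair \<alpha> \<beta>"
    and mean: "measure_pmf.expectation r \<alpha> = measure_pmf.expectation s \<beta>"
    and ge: "measure_pmf.expectation r \<alpha> \<ge> lower_mean"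
    by (rule normalized_schroedinger_pair)
  have half: "EROT c lam r s / 2 = ereal (measure_pmf.expectation r \<alpha>)"
    unfolding EROT_eq[OF sp] mean[symmetric] numeral_eq_ereal ereal_divide by simp
  have plan: "pmf \<pi> (x, y) = gibbs \<alpha> \<beta> (x, y)" if "is_EROT_plan c lam r s \<pi>" for \<pi> x y
    using that is_EROT_plan_iff[OF sp, of \<pi>] by blast
  have summable: "(\<lambda>(x, y). (CX x + CY y) * pmf \<pi> (x, y)) summable_on UNIV"
    if "is_EROT_plan c lam r s \<pi>" for \<pi>
    by (rule coupling_weights_summable[OF _ assms(7,9)])
      (use that in \<open>simp add: is_EROT_plan_def is_arg_min_def\<close>)
  show ?thesis
  proof (intro conjI exI[of _ \<alpha>] exI[of _ \<beta>] allI impI)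
    show "EROT_potentials c lam r s \<alpha> \<beta>" by (rule EROT_potentials_schroedinger[OF sp])
    \<comment> \<open>By \<open>half\<close> the prescribed value is the mean of
      \<open>\<alpha>\<close>, so the normalization fixes the additive constant left free by
      maximality.\<close>
    show "\<alpha>' = \<alpha>" "\<beta>' = \<beta>"
      if "EROT_potentials c lam r s \<alpha>' \<beta>' \<and>
         ereal (measure_pmf.expectation r \<alpha>') = EROT c lam r s / 2 \<and>
         ereal (measure_pmf.expectation s \<beta>') = EROT c lam r s / 2" for \<alpha>' \<beta>'
      using EROT_potentials_unique[OF sp, of \<alpha>' \<beta>'] that unfolding half by simp_all
  qed (use half mean ge schroedinger_pair_bounds[OF sp mean ge] ex1_EROT_plan[OF sp]
        gibbs_bounds[OF sp mean ge] summable in \<open>auto simp: m eqs plan simp del: split_conv\<close>)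
qed

end
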